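(* There exist infinitely many real biquadratic fields $K$ such that the fundamental unit of each of the three quadratic subfields of $K$ has norm $-1$ and the unit signature rank of $K$ is $3$.
   Context: For a totally real field $F$ of degree $n$ and $0\neq\alpha\in F$, the signature of $\alpha$ is the vector in $\mathbb{F}_2^n$ whose entry at a real embedding $v$ is $0$ if $v(\alpha)>0$ and $1$ if $v(\alpha)<0$. The signatures of the units of $F$ form a subspace of $\mathbb{F}_2^n$; its dimension is the unit signature rank of $F$. *)

theory Defs
  imports "HOL-Analysis.Analysis" "HOL-Computational_Algebra.Computational_Algebra" "HOL-Library.Z2"
begin

(* Real biquadratic field K = Q(sqrt a, sqrt b) inside R, a b distinct squarefree integers > 1. *)
definition real_biquadratic :: "int \<Rightarrow> int \<Rightarrow> bool" where
  "real_biquadratic a b \<longleftrightarrow> a > 1 \<and> b > 1 \<and> squarefree a \<and> squarefree b \<and> a \<noteq> b"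

(* Image of q0 + q1 sqrt a + q2 sqrt b + q3 sqrt a sqrt b under the real embedding
   sqrt a \<mapsto> (-1)^s sqrt a, sqrt b \<mapsto> (-1)^t sqrt b.  (s,t) = (False,False) is the identity. *)
definition bq_elt :: "int \<Rightarrow> int \<Rightarrow> bool \<Rightarrow> bool \<Rightarrow> rat \<times> rat \<times> rat \<times> rat \<Rightarrow> real" where
  "bq_elt a b s t q = (case q of (q0, q1, q2, q3) \<Rightarrow>
      of_rat q0 + (if s then -1 else 1) * of_rat q1 * sqrt (of_int a)
      + (if t then -1 else 1) * of_rat q2 * sqrt (of_int b)
      + (if s = t then 1 else -1) * of_rat q3 * sqrt (of_int a) * sqrt (of_int b))"

definition biquad_field :: "int \<Rightarrow> int \<Rightarrow> real set" where
  "biquad_field a b = {bq_elt a b False False q | q. True}"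

(* units of the ring of integers of K (given by their rational coordinates) *)
definition bq_units :: "int \<Rightarrow> int \<Rightarrow> (rat \<times> rat \<times> rat \<times> rat) set" where
  "bq_units a b = {q. bq_elt a b False False q \<noteq> 0 \<and> algebraic_int (bq_elt a b False False q)
                      \<and> algebraic_int (1 / bq_elt a b False False q)}"

(* signature vector in F_2^4, indexed by the four real embeddings *)
definition bq_signature :: "int \<Rightarrow> int \<Rightarrow> rat \<times> rat \<times> rat \<times> rat \<Rightarrow> bit ^ (bool \<times> bool)" where
  "bq_signature a b q = (\<chi> i. if bq_elt a b (fst i) (snd i) q < 0 then 1 else 0)"

(* dimension over F_2 of the space of unit signatures *)
definition unit_signature_rank :: "int \<Rightarrow> int \<Rightarrow> nat" where
  "unit_signature_rank a b =
     vector_space.dim ((*s) :: bit \<Rightarrow> bit ^ (bool \<times> bool) \<Rightarrow> bit ^ (bool \<times> bool))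
       (bq_signature a b ` bq_units a b)"

(* real quadratic field Q(sqrt d): element x + y sqrt d *)
definition quad_elt :: "int \<Rightarrow> rat \<times> rat \<Rightarrow> real" where
  "quad_elt d p = of_rat (fst p) + of_rat (snd p) * sqrt (of_int d)"

definition quad_units :: "int \<Rightarrow> (rat \<times> rat) set" where
  "quad_units d = {p. quad_elt d p \<noteq> 0 \<and> algebraic_int (quad_elt d p) \<and> algebraic_int (1 / quad_elt d p)}"

definition quad_norm :: "int \<Rightarrow> rat \<times> rat \<Rightarrow> rat" where
  "quad_norm d p = (fst p)^2 - of_int d * (snd p)^2"

(* fundamental unit: the unit eps > 1 with every unit equal to \<plusminus> eps^k, k \<in> Z *)
definition fundamental_unit :: "int \<Rightarrow> rat \<times> rat \<Rightarrow> bool" where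
  "fundamental_unit d e \<longleftrightarrow> e \<in> quad_units d \<and> quad_elt d e > 1 \<and>
     (\<forall>u \<in> quad_units d. \<exists>k::int. quad_elt d u = quad_elt d e powi k \<or> quad_elt d u = - (quad_elt d e powi k))"

end

theory Submission
  imports Defs "Jordan_Normal_Form.Char_Poly" "HOL-Number_Theory.Cong"
begin

text \<open>The fields are \<open>K = \<rat>(\<surd>a, \<surd>b)\<close> with \<open>a\<close>, \<open>b\<close> the squarefree parts of \<open>m\<^sup>2 + 1\<close> and
  \<open>(m + 1)\<^sup>2 + 1\<close>, \<open>m \<equiv> 4 (mod 169)\<close>. Since \<open>(m\<^sup>2 + 1)((m + 1)\<^sup>2 + 1) = (m\<^sup>2 + m + 1)\<^sup>2 + 1\<close>,
  each quadratic subfield contains a unit of norm \<open>-1\<close>, so its fundamental unit has norm \<open>-1\<close>, and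
  together with \<open>-1\<close> these units have signatures spanning the even-weight hyperplane of \<open>\<bbbF>\<^sub>2\<^sup>4\<close>.
  No unit \<open>q\<close> of \<open>K\<close> has negative norm: otherwise its relative norm \<open>\<alpha>\<close> to \<open>\<rat>(\<surd>a)\<close> has norm
  \<open>-1\<close>, so \<open>\<alpha>\<epsilon> = \<plusminus>w\<^sup>2\<close> for the unit \<open>\<epsilon> = m + f\<^sub>a\<surd>a\<close>, \<open>af\<^sub>a\<^sup>2 = m\<^sup>2 + 1\<close>; modulo \<open>13\<close>, which divides \<open>b\<close> but not \<open>a\<close>,
  \<open>\<alpha>\<close> becomes a square, forcing \<open>\<epsilon> \<equiv> 6\<close> to be a square mod \<open>13\<close>. So the signature rank is \<open>3\<close>.
  Infinitely many of these fields are distinct: \<open>\<surd>d \<in> K\<close> forces \<open>d \<le> ab\<close>, while the squarefree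
  part of \<open>m\<^sup>2 + 1\<close> is unbounded along the progression.\<close>

section \<open>Algebraic integers form a ring\<close>

lemma algebraic_int_of_int_matrix_eigenvalue:
  fixes x :: real and M :: "int mat" and v :: "real Matrix.vec"
  assumes M: "M \<in> carrier_mat n n" and v: "v \<in> carrier_vec n" "v \<noteq> 0\<^sub>v n"
    and eigen: "map_mat real_of_int M *\<^sub>v v = x \<cdot>\<^sub>v v"
  shows "algebraic_int x"
proof -
  have "eigenvalue (map_mat real_of_int M) x"
    unfolding eigenvalue_def eigenvector_def using M v eigen by (intro exI[of _ v]) auto
  then have "poly (char_poly (map_mat real_of_int M)) x = 0"
    using eigenvalue_root_char_poly[of "map_mat real_of_int M" n] M by simp
  moreover have "char_poly (map_mat real_of_int M) = map_poly of_int (char_poly M)"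
    by (rule of_int_hom.char_poly_hom[OF M])
  moreover have "lead_coeff (char_poly M) = 1"
    using degree_monic_char_poly[OF M] by simp
  ultimately show ?thesis by (auto simp: algebraic_int_altdef_ipoly)
qed

text \<open>If \<open>x\<close> and \<open>y\<close> are roots of monic integer polynomials of degrees \<open>n\<close> and \<open>m\<close>, then \<open>x + y\<close>
  and \<open>xy\<close> act by integer matrices on the span of \<open>x\<^sup>iy\<^sup>j\<close> (\<open>i < n\<close>, \<open>j < m\<close>), so they are
  eigenvalues of integer matrices.\<close>

definition integral_action :: "('i \<Rightarrow> real) \<Rightarrow> 'i set \<Rightarrow> real \<Rightarrow> bool" where
  "integral_action w I x \<longleftrightarrow>
     (\<exists>M::'i \<Rightarrow> 'i \<Rightarrow> int. \<forall>k\<in>I. x * w k = (\<Sum>k'\<in>I. of_int (M k k') * w k'))"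

lemma integral_action_reindex:
  assumes "bij_betw h J I" "integral_action w I x"
  shows "integral_action (w \<circ> h) J x"
proof -
  obtain M where M: "\<And>k. k \<in> I \<Longrightarrow> x * w k = (\<Sum>k'\<in>I. of_int (M k k') * w k')"
    using assms(2) unfolding integral_action_def by auto
  show ?thesis
    unfolding integral_action_def
  proof (intro exI[of _ "\<lambda>k k'. M (h k) (h k')"] ballI)
    fix k assume "k \<in> J"
    then have "h k \<in> I" using assms(1) by (auto simp: bij_betw_def)
    then show "x * (w \<circ> h) k = (\<Sum>k'\<in>J. of_int (M (h k) (h k')) * (w \<circ> h) k')"
      using M sum.reindex_bij_betw[OF assms(1), of "\<lambda>k'. of_int (M (h k) k') * w k'"] by simp
  qed
qed

lemma integral_action_algebraic_int_nat:
  fixes w :: "nat \<Rightarrow> real"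
  assumes "integral_action w {..<n} x" "k0 < n" "w k0 \<noteq> 0"
  shows "algebraic_int x"
proof -
  obtain M where M: "\<And>k. k < n \<Longrightarrow> x * w k = (\<Sum>k'<n. of_int (M k k') * w k')"
    using assms(1) unfolding integral_action_def by auto
  define A where "A = mat n n (\<lambda>(i, j). M i j)"
  define v where "v = Matrix.vec n w"
  have A: "A \<in> carrier_mat n n" and v: "v \<in> carrier_vec n"
    unfolding A_def v_def by simp_all
  have "v \<noteq> 0\<^sub>v n"
    using assms(2,3) unfolding v_def by (metis index_vec index_zero_vec(1))
  moreover have "map_mat real_of_int A *\<^sub>v v = x \<cdot>\<^sub>v v"
  proof (rule eq_vecI)
    fix i assume "i < dim_vec (x \<cdot>\<^sub>v v)"
    then have i: "i < n" using v by simp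
    have "Matrix.vec_index (map_mat real_of_int A *\<^sub>v v) i = (\<Sum>k'<n. of_int (M i k') * w k')"
      using i unfolding A_def v_def
      by (auto simp: scalar_prod_def lessThan_atLeast0 intro!: sum.cong)
    also have "\<dots> = Matrix.vec_index (x \<cdot>\<^sub>v v) i"
      using M[OF i] i unfolding v_def by simp
    finally show "Matrix.vec_index (map_mat real_of_int A *\<^sub>v v) i = Matrix.vec_index (x \<cdot>\<^sub>v v) i" .
  qed (use A v in auto)
  ultimately show ?thesis
    using algebraic_int_of_int_matrix_eigenvalue[OF A v] by blast
qed

lemma integral_action_algebraic_int:
  assumes "finite I" "integral_action w I x" "k0 \<in> I" "w k0 \<noteq> 0"
  shows "algebraic_int x"
proof -
  obtain h where h: "bij_betw h {..<card I} I"
    using assms(1) by (metis ex_bij_betw_nat_finite lessThan_atLeast0)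
  then obtain k1 where "k1 < card I" "h k1 = k0"
    using assms(3) by (metis bij_betw_iff_bijections lessThan_iff)
  then show ?thesis
    using integral_action_algebraic_int_nat[OF integral_action_reindex[OF h assms(2)]] assms(4)
    by auto
qed

lemma integral_action_add:
  assumes "integral_action w I x" "integral_action w I y"
  shows "integral_action w I (x + y)"
proof -
  obtain M where M: "\<And>k. k \<in> I \<Longrightarrow> x * w k = (\<Sum>k'\<in>I. of_int (M k k') * w k')"
    using assms(1) unfolding integral_action_def by auto
  obtain N where N: "\<And>k. k \<in> I \<Longrightarrow> y * w k = (\<Sum>k'\<in>I. of_int (N k k') * w k')"
    using assms(2) unfolding integral_action_def by auto
  show ?thesis
    unfolding integral_action_def
    by (intro exI[of _ "\<lambda>k k'. M k k' + N k k'"] ballI)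
       (simp add: distrib_right M N sum.distrib)
qed

lemma integral_action_mult:
  assumes "integral_action w I x" "integral_action w I y"
  shows "integral_action w I (x * y)"
proof -
  obtain M where M: "\<And>k. k \<in> I \<Longrightarrow> x * w k = (\<Sum>k'\<in>I. of_int (M k k') * w k')"
    using assms(1) unfolding integral_action_def by auto
  obtain N where N: "\<And>k. k \<in> I \<Longrightarrow> y * w k = (\<Sum>k'\<in>I. of_int (N k k') * w k')"
    using assms(2) unfolding integral_action_def by auto
  show ?thesis
    unfolding integral_action_def
  proof (intro exI[of _ "\<lambda>k k''. \<Sum>k'\<in>I. N k k' * M k' k''"] ballI)
    fix k assume k: "k \<in> I"
    have "x * y * w k = (\<Sum>k'\<in>I. of_int (N k k') * (x * w k'))"
      using N[OF k] by (simp add: sum_distrib_left mult_ac)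
    also have "\<dots> = (\<Sum>k'\<in>I. \<Sum>k''\<in>I. of_int (N k k') * of_int (M k' k'') * w k'')"
      by (simp add: M sum_distrib_left mult_ac)
    also have "\<dots> = (\<Sum>k''\<in>I. of_int (\<Sum>k'\<in>I. N k k' * M k' k'') * w k'')"
      by (subst sum.swap) (simp add: sum_distrib_right)
    finally show "x * y * w k = (\<Sum>k''\<in>I. of_int (\<Sum>k'\<in>I. N k k' * M k' k'') * w k'')" .
  qed
qed

lemma algebraic_int_obtain_monic:
  fixes x :: real
  assumes "algebraic_int x"
  obtains p :: "int poly"
  where "poly (map_poly of_int p) x = 0" "lead_coeff p = 1" "degree p > 0"
proof -
  obtain p :: "int poly" where p: "poly (map_poly of_int p) x = 0" "lead_coeff p = 1"
    using assms by (auto simp: algebraic_int_altdef_ipoly)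
  moreover have "degree p > 0"
  proof (rule ccontr)
    assume "\<not> degree p > 0"
    then have "p = 1" using p(2) by (metis degree_0_id gr0I one_pCons)
    then show False using p(1) by simp
  qed
  ultimately show ?thesis using that by blast
qed

lemma monic_root_power_degree:
  fixes p :: "int poly" and x :: real
  assumes "poly (map_poly of_int p) x = 0" "lead_coeff p = 1"
  shows "x ^ degree p = - (\<Sum>i<degree p. of_int (coeff p i) * x ^ i)"
proof -
  have "0 = (\<Sum>i\<le>degree p. of_int (coeff p i) * x ^ i)"
    using assms(1) by (simp add: poly_altdef degree_map_poly coeff_map_poly)
  also have "\<dots> = (\<Sum>i<degree p. of_int (coeff p i) * x ^ i) + x ^ degree p"
    using assms(2) by (simp add: lessThan_Suc_atMost[symmetric])
  finally show ?thesis by linarith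
qed

text \<open>The matrix is the companion matrix of \<open>p\<close>, acting on the first index.\<close>

lemma integral_action_powers:
  fixes x :: real and z :: "'j \<Rightarrow> real"
  assumes x: "poly (map_poly of_int p) x = 0" "lead_coeff p = 1" and J: "finite J"
  shows "integral_action (\<lambda>k. x ^ fst k * z (snd k)) ({..<degree p} \<times> J) x"
proof -
  let ?n = "degree p" and ?I = "{..<degree p} \<times> J" and ?w = "\<lambda>k. x ^ fst k * z (snd k)"
  define M where "M = (\<lambda>(k::nat \<times> 'j) k'. if fst k + 1 < ?n then (if k' = (fst k + 1, snd k) then 1 else 0)
                            else if snd k' = snd k then - coeff p (fst k') else (0::int))"
  have "x * ?w k = (\<Sum>k'\<in>?I. of_int (M k k') * ?w k')" if "k \<in> ?I" for k
  proof -
    obtain i j where ij: "k = (i, j)" "i < ?n" "j \<in> J" using \<open>k \<in> ?I\<close> by auto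
    show ?thesis
    proof (cases "i + 1 < ?n")
      case True
      then have "(\<Sum>k'\<in>?I. of_int (M k k') * ?w k') = (\<Sum>k'\<in>?I. if k' = (i + 1, j) then ?w k' else 0)"
        by (intro sum.cong) (simp_all add: M_def ij)
      also have "\<dots> = ?w (i + 1, j)" using True ij J by (simp add: sum.delta)
      finally show ?thesis using ij by simp
    next
      case False
      then have i: "Suc i = ?n" using ij by auto
      have "(\<Sum>k'\<in>?I. of_int (M k k') * ?w k')
          = (\<Sum>k'\<in>?I. if snd k' = j then - of_int (coeff p (fst k')) * ?w k' else 0)"
        by (intro sum.cong) (use False in \<open>simp_all add: M_def ij\<close>)
      also have "\<dots> = (\<Sum>i'<?n. \<Sum>j'\<in>J. if j' = j then - of_int (coeff p i') * (x ^ i' * z j') else 0)"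
        by (simp add: sum.cartesian_product case_prod_beta)
      also have "\<dots> = (\<Sum>i'<?n. - of_int (coeff p i') * (x ^ i' * z j))"
        using ij J by (intro sum.cong) (simp_all add: sum.delta')
      also have "\<dots> = x ^ ?n * z j"
        unfolding monic_root_power_degree[OF x] by (simp add: sum_negf sum_distrib_right mult.assoc)
      finally show ?thesis by (simp add: ij flip: i)
    qed
  qed
  then show ?thesis unfolding integral_action_def by blast
qed

lemma
  fixes x y :: real
  assumes "algebraic_int x" "algebraic_int y"
  shows algebraic_int_add: "algebraic_int (x + y)"
    and algebraic_int_mult: "algebraic_int (x * y)"
proof -
  obtain p where p: "poly (map_poly of_int p) x = 0" "lead_coeff p = 1" "degree p > 0"
    using algebraic_int_obtain_monic[OF assms(1)] by blast
  obtain q where q: "poly (map_poly of_int q) y = 0" "lead_coeff q = 1" "degree q > 0"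
    using algebraic_int_obtain_monic[OF assms(2)] by blast
  define I where "I = {..<degree p} \<times> {..<degree q}"
  define w where "w = (\<lambda>k. x ^ fst k * y ^ snd k)"
  have fin: "finite I" and w00: "(0, 0) \<in> I" "w (0, 0) \<noteq> 0"
    using p(3) q(3) unfolding I_def w_def by auto
  have x: "integral_action w I x"
    unfolding I_def w_def by (rule integral_action_powers[OF p(1,2)]) simp
  have "integral_action ((\<lambda>k. y ^ fst k * x ^ snd k) \<circ> prod.swap) I y"
    unfolding I_def
    by (rule integral_action_reindex[OF _ integral_action_powers[OF q(1,2)]])
       (auto simp: bij_betw_def product_swap)
  then have y: "integral_action w I y"
    by (simp add: w_def comp_def mult.commute)
  show "algebraic_int (x + y)"
    by (rule integral_action_algebraic_int[OF fin integral_action_add[OF x y] w00])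
  show "algebraic_int (x * y)"
    by (rule integral_action_algebraic_int[OF fin integral_action_mult[OF x y] w00])
qed

section \<open>Square roots of squarefree integers\<close>

lemma squarefree_times_rat_square_Ints:
  fixes d :: int and z :: rat
  assumes "squarefree d" "of_int d * z\<^sup>2 \<in> \<int>"
  shows "z \<in> \<int>"
proof -
  obtain n k where nk: "quotient_of z = (n, k)" by (cases "quotient_of z")
  have k: "k > 0" and cop: "coprime n k" and z: "z = of_int n / of_int k"
    using nk quotient_of_denom_pos quotient_of_coprime quotient_of_div by blast+
  from assms(2) obtain M where M: "of_int d * z\<^sup>2 = of_int M" by (rule Ints_cases)
  have "of_int (d * n\<^sup>2) = (of_int (M * k\<^sup>2) :: rat)"
    using M k unfolding z by (simp add: field_simps power2_eq_square)
  then have "k\<^sup>2 dvd d * n\<^sup>2" by (metis dvd_triv_right of_int_eq_iff)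
  moreover have "coprime (k\<^sup>2) (n\<^sup>2)" using cop by (simp add: coprime_commute)
  ultimately have "k\<^sup>2 dvd d" by (simp add: coprime_dvd_mult_left_iff)
  then have "k = 1" using assms(1) k squarefreeD[of d k] by simp
  then show ?thesis using z by simp
qed

lemma squarefree_eq_of_times_rat_square:
  fixes a b :: int and r :: rat
  assumes "squarefree a" "squarefree b" "a > 0" "b > 0" "of_int a * r\<^sup>2 = of_int b"
  shows "a = b"
proof -
  have "r \<in> \<int>" using squarefree_times_rat_square_Ints[OF assms(1)] assms(5) by simp
  then obtain n where n: "r = of_int n" by (rule Ints_cases)
  then have b: "b = a * n\<^sup>2" using assms(5) by (metis of_int_eq_iff of_int_mult of_int_power)
  then have "\<bar>n\<bar> = 1" using assms(2) squarefreeD[of b n] by simp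
  then show ?thesis using b by (metis power2_abs one_power2 mult_1_right)
qed

lemma squarefree_not_rat_square:
  fixes n :: int and r :: rat
  assumes "squarefree n" "n > 1"
  shows "r\<^sup>2 \<noteq> of_int n"
  using squarefree_eq_of_times_rat_square[of 1 n r] assms by auto

lemma sqrt_squarefree_not_rat:
  fixes n :: int
  assumes "squarefree n" "n > 1"
  shows "sqrt (of_int n) \<noteq> of_rat r"
proof
  assume h: "sqrt (of_int n) = of_rat r"
  have "(of_rat r :: real)\<^sup>2 = (sqrt (of_int n))\<^sup>2" by (simp add: h)
  also have "\<dots> = of_int n" using assms(2) by simp
  finally have "of_rat (r\<^sup>2) = (of_rat (of_int n) :: real)" by (simp add: of_rat_power)
  then show False using squarefree_not_rat_square[OF assms] of_rat_eq_iff by blast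
qed

lemma rat_plus_rat_sqrt_eq_0:
  fixes n :: int and x y :: rat
  assumes "squarefree n" "n > 1" "of_rat x + of_rat y * sqrt (of_int n) = 0"
  shows "x = 0 \<and> y = 0"
proof (cases "y = 0")
  case True
  then show ?thesis using assms(3) by simp
next
  case False
  then have "sqrt (of_int n) = of_rat (- x / y)"
    using assms(3) by (simp add: field_simps of_rat_divide of_rat_minus)
  then show ?thesis using sqrt_squarefree_not_rat[OF assms(1,2)] by blast
qed

lemma squarefree_le_of_eq_rat_square_times:
  fixes d c :: int and z :: rat
  assumes "squarefree d" "d > 0" "c > 0" "of_int d = z\<^sup>2 * of_int c"
  shows "d \<le> c"
proof -
  have z: "z \<noteq> 0" using assms(2,4) by auto
  have "of_int d * (1 / z)\<^sup>2 = of_int c"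
    using assms(4) z by (simp add: field_simps power2_eq_square)
  moreover have "1 / z \<in> \<int>"
    using squarefree_times_rat_square_Ints[OF assms(1)] calculation by simp
  then obtain k where k: "1 / z = of_int k" by (rule Ints_cases)
  ultimately have c: "c = d * k\<^sup>2" by (metis of_int_eq_iff of_int_mult of_int_power)
  have "k \<noteq> 0" using k z by auto
  then have "1 \<le> k\<^sup>2" by (simp add: int_one_le_iff_zero_less)
  then have "d * 1 \<le> d * k\<^sup>2" using assms(2) by (intro mult_left_mono) auto
  then show ?thesis using c by simp
qed

section \<open>Real biquadratic fields\<close>

lemma real_biquadratic_nonneg:
  assumes "real_biquadratic a b"
  shows "a \<ge> 0" "b \<ge> 0"
  using assms unfolding real_biquadratic_def by auto

definition neg_if :: "bool \<Rightarrow> rat \<Rightarrow> rat" where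
  "neg_if s x = (if s then - x else x)"

definition bq_conj :: "bool \<Rightarrow> bool \<Rightarrow> rat \<times> rat \<times> rat \<times> rat \<Rightarrow> rat \<times> rat \<times> rat \<times> rat" where
  "bq_conj s t q = (case q of (q0, q1, q2, q3) \<Rightarrow> (q0, neg_if s q1, neg_if t q2, neg_if (s \<noteq> t) q3))"

definition bq_times ::
  "int \<Rightarrow> int \<Rightarrow> rat \<times> rat \<times> rat \<times> rat \<Rightarrow> rat \<times> rat \<times> rat \<times> rat \<Rightarrow> rat \<times> rat \<times> rat \<times> rat" where
  "bq_times a b q r = (case q of (q0, q1, q2, q3) \<Rightarrow> case r of (r0, r1, r2, r3) \<Rightarrow>
     (q0*r0 + of_int a*q1*r1 + of_int b*q2*r2 + of_int a * of_int b*q3*r3,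
      q0*r1 + q1*r0 + of_int b*(q2*r3 + q3*r2),
      q0*r2 + q2*r0 + of_int a*(q1*r3 + q3*r1),
      q0*r3 + q3*r0 + q1*r2 + q2*r1))"

lemma bq_elt_expand:
  "bq_elt a b s t (q0, q1, q2, q3) =
     of_rat q0 + of_rat (neg_if s q1) * sqrt (of_int a) + of_rat (neg_if t q2) * sqrt (of_int b)
     + of_rat (neg_if (s \<noteq> t) q3) * sqrt (of_int a) * sqrt (of_int b)"
  by (auto simp: bq_elt_def neg_if_def of_rat_minus)

lemma bq_elt_const [simp]: "bq_elt a b s t (c, 0, 0, 0) = of_rat c"
  by (simp add: bq_elt_expand neg_if_def)

lemma bq_elt_conj_id: "bq_elt a b s t q = bq_elt a b False False (bq_conj s t q)"
  by (cases q) (auto simp: bq_elt_expand bq_conj_def neg_if_def)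

lemma bq_conj_conj: "bq_conj s t (bq_conj s' t' q) = bq_conj (s \<noteq> s') (t \<noteq> t') q"
  by (cases q) (auto simp: bq_conj_def neg_if_def)

lemma bq_elt_conj: "bq_elt a b s t (bq_conj s' t' q) = bq_elt a b (s \<noteq> s') (t \<noteq> t') q"
  by (metis bq_elt_conj_id bq_conj_conj)

lemma bq_conj_id [simp]: "bq_conj False False q = q"
  by (cases q) (simp add: bq_conj_def neg_if_def)

lemma bq_elt_add: "bq_elt a b s t (q + r) = bq_elt a b s t q + bq_elt a b s t r"
  by (cases q; cases r) (simp add: bq_elt_expand neg_if_def of_rat_add of_rat_diff of_rat_minus algebra_simps)

lemma bq_elt_diff: "bq_elt a b s t (q - r) = bq_elt a b s t q - bq_elt a b s t r"
  by (cases q; cases r) (simp add: bq_elt_expand neg_if_def of_rat_diff of_rat_minus algebra_simps)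

lemma bq_elt_times_id:
  assumes "a \<ge> 0" "b \<ge> 0"
  shows "bq_elt a b False False (bq_times a b q r) = bq_elt a b False False q * bq_elt a b False False r"
proof -
  obtain q0 q1 q2 q3 r0 r1 r2 r3 where qr: "q = (q0, q1, q2, q3)" "r = (r0, r1, r2, r3)"
    by (metis prod_cases4)
  define A where "A = sqrt (of_int a :: real)"
  define B where "B = sqrt (of_int b :: real)"
  have ea: "(of_int a :: real) = A * A" and eb: "(of_int b :: real) = B * B"
    unfolding A_def B_def using assms by simp_all
  have "bq_elt a b False False (bq_times a b q r) =
     (of_rat q0 * of_rat r0 + of_int a * of_rat q1 * of_rat r1 + of_int b * of_rat q2 * of_rat r2
        + of_int a * of_int b * of_rat q3 * of_rat r3)
     + (of_rat q0 * of_rat r1 + of_rat q1 * of_rat r0 + of_int b * (of_rat q2 * of_rat r3 + of_rat q3 * of_rat r2)) * A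
     + (of_rat q0 * of_rat r2 + of_rat q2 * of_rat r0 + of_int a * (of_rat q1 * of_rat r3 + of_rat q3 * of_rat r1)) * B
     + (of_rat q0 * of_rat r3 + of_rat q3 * of_rat r0 + of_rat q1 * of_rat r2 + of_rat q2 * of_rat r1) * A * B"
    unfolding qr bq_times_def by (simp add: bq_elt_expand neg_if_def of_rat_add of_rat_mult A_def B_def)
  also have "\<dots> = (of_rat q0 + of_rat q1 * A + of_rat q2 * B + of_rat q3 * A * B) *
                   (of_rat r0 + of_rat r1 * A + of_rat r2 * B + of_rat r3 * A * B)"
    unfolding ea eb by (simp add: algebra_simps)
  also have "\<dots> = bq_elt a b False False q * bq_elt a b False False r"
    unfolding qr by (simp add: bq_elt_expand neg_if_def A_def B_def)
  finally show ?thesis .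
qed

lemma bq_conj_times: "bq_conj s t (bq_times a b q r) = bq_times a b (bq_conj s t q) (bq_conj s t r)"
  by (cases q; cases r; cases s; cases t) (simp_all add: bq_conj_def bq_times_def neg_if_def algebra_simps)

lemma bq_elt_times:
  assumes "a \<ge> 0" "b \<ge> 0"
  shows "bq_elt a b s t (bq_times a b q r) = bq_elt a b s t q * bq_elt a b s t r"
  by (metis bq_elt_conj_id bq_conj_times bq_elt_times_id[OF assms])

text \<open>Clearing \<open>\<surd>b\<close> by multiplying with \<open>q\<^sub>2 - q\<^sub>3\<surd>a\<close> and then \<open>\<surd>a\<close> by squaring reduces
  linear independence of the basis to the irrationality of \<open>\<surd>a\<close>, \<open>\<surd>b\<close> and \<open>\<surd>(a/b)\<close>.\<close>

lemma bq_elt_id_eq_0: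
  assumes ab: "real_biquadratic a b" and h: "bq_elt a b False False q = 0"
  shows "q = (0, 0, 0, 0)"
proof -
  obtain q0 q1 q2 q3 where q: "q = (q0, q1, q2, q3)" by (metis prod_cases4)
  have a: "a > 1" "squarefree a" and b: "b > 1" "squarefree b" and "a \<noteq> b"
    using ab unfolding real_biquadratic_def by auto
  define A where "A = sqrt (of_int a :: real)"
  define B where "B = sqrt (of_int b :: real)"
  have ea: "A * A = of_int a" and eb: "B * B = of_int b"
    unfolding A_def B_def using a b by simp_all
  define c where "c = q0 * q2 - of_int a * q1 * q3"
  define d where "d = q1 * q2 - q0 * q3"
  define n where "n = q2\<^sup>2 - of_int a * q3\<^sup>2"
  have h1: "(of_rat q0 + of_rat q1 * A) + (of_rat q2 + of_rat q3 * A) * B = 0"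
    using h unfolding q by (simp add: bq_elt_expand neg_if_def A_def B_def algebra_simps)
  have "(of_rat c + of_rat d * A) + of_rat n * B =
        ((of_rat q0 + of_rat q1 * A) + (of_rat q2 + of_rat q3 * A) * B) * (of_rat q2 - of_rat q3 * A)"
    unfolding c_def d_def n_def
    by (simp add: of_rat_add of_rat_mult of_rat_diff of_rat_power algebra_simps power2_eq_square flip: ea)
  then have "of_rat c + of_rat d * A = - (of_rat n * B)" using h1 by simp
  then have "(of_rat c + of_rat d * A)\<^sup>2 = (of_rat n)\<^sup>2 * (B * B)"
    by (simp add: power2_eq_square algebra_simps)
  then have "of_rat (c\<^sup>2 + of_int a * d\<^sup>2 - of_int b * n\<^sup>2) + of_rat (2 * c * d) * A = 0"
    unfolding eb
    by (simp add: of_rat_add of_rat_mult of_rat_diff of_rat_power algebra_simps power2_eq_square flip: ea)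
  from rat_plus_rat_sqrt_eq_0[OF a(2) a(1) this[unfolded A_def]]
  have e1: "c\<^sup>2 + of_int a * d\<^sup>2 = of_int b * n\<^sup>2" and e2: "c * d = 0" by auto
  have n0: "n = 0"
  proof (rule ccontr)
    assume n: "n \<noteq> 0"
    show False
    proof (cases "c = 0")
      case True
      then have "of_int a * (d / n)\<^sup>2 = of_int b" using e1 n by (simp add: field_simps)
      then show False
        using squarefree_eq_of_times_rat_square[OF a(2) b(2)] a b \<open>a \<noteq> b\<close> by simp
    next
      case False
      then have "(c / n)\<^sup>2 = of_int b" using e1 e2 n by (simp add: field_simps)
      then show False using squarefree_not_rat_square[OF b(2) b(1)] by blast
    qed
  qed
  have q3: "q3 = 0"
  proof (rule ccontr)
    assume "q3 \<noteq> 0"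
    then have "(q2 / q3)\<^sup>2 = of_int a" using n0 unfolding n_def by (simp add: field_simps)
    then show False using squarefree_not_rat_square[OF a(2) a(1)] by blast
  qed
  have q2: "q2 = 0" using n0 q3 unfolding n_def by simp
  have "of_rat q0 + of_rat q1 * sqrt (of_int a) = 0" using h1 q2 q3 unfolding A_def by simp
  from rat_plus_rat_sqrt_eq_0[OF a(2) a(1) this] q2 q3 show ?thesis unfolding q by simp
qed

lemma bq_elt_eq_0:
  assumes "real_biquadratic a b" "bq_elt a b s t q = 0"
  shows "q = (0, 0, 0, 0)"
proof -
  have "bq_conj s t q = (0, 0, 0, 0)"
    using bq_elt_id_eq_0[OF assms(1)] assms(2) bq_elt_conj_id by metis
  then have "bq_conj s t (bq_conj s t q) = (0, 0, 0, 0)" by (simp add: bq_conj_def neg_if_def)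
  then show ?thesis by (simp add: bq_conj_conj)
qed

lemma bq_elt_nonzero:
  assumes "real_biquadratic a b" "bq_elt a b s0 t0 q \<noteq> 0"
  shows "bq_elt a b s t q \<noteq> 0"
  using bq_elt_eq_0[OF assms(1)] assms(2) by fastforce

lemma bq_elt_inject:
  assumes ab: "real_biquadratic a b" and h: "bq_elt a b s t q = bq_elt a b s t r"
  shows "q = r"
proof -
  have "bq_elt a b s t (q - r) = 0" using h by (simp add: bq_elt_diff)
  from bq_elt_eq_0[OF ab this] show ?thesis
    by (cases q; cases r) simp
qed

definition bq_conjugates :: "int \<Rightarrow> int \<Rightarrow> (bool \<Rightarrow> bool \<Rightarrow> real) \<Rightarrow> bool" where
  "bq_conjugates a b f \<longleftrightarrow> (\<exists>q. \<forall>s t. f s t = bq_elt a b s t q)"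

lemma bq_conjugates_const: "bq_conjugates a b (\<lambda>s t. of_rat c)"
  unfolding bq_conjugates_def by (intro exI[of _ "(c, 0, 0, 0)"]) simp

lemma bq_conjugates_elt: "bq_conjugates a b (\<lambda>s t. bq_elt a b s t q)"
  unfolding bq_conjugates_def by blast

lemma bq_conjugates_add:
  "bq_conjugates a b f \<Longrightarrow> bq_conjugates a b g \<Longrightarrow> bq_conjugates a b (\<lambda>s t. f s t + g s t)"
  unfolding bq_conjugates_def by (metis bq_elt_add)

lemma bq_conjugates_mult:
  "a \<ge> 0 \<Longrightarrow> b \<ge> 0 \<Longrightarrow> bq_conjugates a b f \<Longrightarrow> bq_conjugates a b g \<Longrightarrow>
     bq_conjugates a b (\<lambda>s t. f s t * g s t)"
  unfolding bq_conjugates_def by (metis bq_elt_times)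

lemma bq_conjugates_sum:
  "finite S \<Longrightarrow> (\<And>i. i \<in> S \<Longrightarrow> bq_conjugates a b (g i)) \<Longrightarrow>
     bq_conjugates a b (\<lambda>s t. \<Sum>i\<in>S. g i s t)"
proof (induction S rule: finite_induct)
  case empty
  then show ?case using bq_conjugates_const[of a b 0] by simp
next
  case (insert x F)
  then show ?case using bq_conjugates_add[of a b "g x" "\<lambda>s t. \<Sum>i\<in>F. g i s t"] by simp
qed

lemma bq_conjugates_power:
  "a \<ge> 0 \<Longrightarrow> b \<ge> 0 \<Longrightarrow> bq_conjugates a b f \<Longrightarrow> bq_conjugates a b (\<lambda>s t. f s t ^ n)"
proof (induction n)
  case 0
  then show ?case using bq_conjugates_const[of a b 1] by simp
next
  case (Suc n)
  then show ?case using bq_conjugates_mult[of a b f "\<lambda>s t. f s t ^ n"] by simp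
qed

lemma bq_conjugates_poly:
  fixes p :: "int poly"
  assumes "a \<ge> 0" "b \<ge> 0"
  shows "bq_conjugates a b (\<lambda>s t. poly (map_poly of_int p) (bq_elt a b s t q))"
proof -
  have "bq_conjugates a b (\<lambda>s t. of_int (coeff p i))" for i
    using bq_conjugates_const[of a b "of_int (coeff p i)"] by simp
  then have "bq_conjugates a b (\<lambda>s t. \<Sum>i\<le>degree p. of_int (coeff p i) * bq_elt a b s t q ^ i)"
    by (intro bq_conjugates_sum bq_conjugates_mult[OF assms]
          bq_conjugates_power[OF assms bq_conjugates_elt]) auto
  then show ?thesis by (simp add: poly_altdef degree_map_poly coeff_map_poly)
qed

text \<open>A monic integer polynomial vanishing at one embedding of an element has zero coordinates
  there, hence vanishes at every embedding.\<close>

lemma algebraic_int_bq_elt_conj: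
  assumes ab: "real_biquadratic a b" and h: "algebraic_int (bq_elt a b s0 t0 q)"
  shows "algebraic_int (bq_elt a b s t q)"
proof -
  obtain p :: "int poly" where p: "poly (map_poly of_int p) (bq_elt a b s0 t0 q) = 0" "lead_coeff p = 1"
    using h by (auto simp: algebraic_int_altdef_ipoly)
  obtain Q where Q: "\<And>s t. poly (map_poly of_int p) (bq_elt a b s t q) = bq_elt a b s t Q"
    using bq_conjugates_poly[OF real_biquadratic_nonneg[OF ab], of p q]
    unfolding bq_conjugates_def by blast
  have "Q = (0, 0, 0, 0)" using bq_elt_eq_0[OF ab] p(1) Q[of s0 t0] by simp
  then have "poly (map_poly of_int p) (bq_elt a b s t q) = 0" using Q by simp
  then show ?thesis using p(2) by (auto simp: algebraic_int_altdef_ipoly)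
qed

definition bq_norm :: "int \<Rightarrow> int \<Rightarrow> rat \<times> rat \<times> rat \<times> rat \<Rightarrow> real" where
  "bq_norm a b q = bq_elt a b False False q * bq_elt a b False True q
                   * bq_elt a b True False q * bq_elt a b True True q"

definition bq_norm_cofactor :: "int \<Rightarrow> int \<Rightarrow> rat \<times> rat \<times> rat \<times> rat \<Rightarrow> rat \<times> rat \<times> rat \<times> rat" where
  "bq_norm_cofactor a b q =
     bq_times a b (bq_conj False True q) (bq_times a b (bq_conj True False q) (bq_conj True True q))"

lemma bq_elt_times_norm_cofactor:
  assumes "a \<ge> 0" "b \<ge> 0"
  shows "bq_elt a b s t (bq_times a b q (bq_norm_cofactor a b q)) = bq_norm a b q"
  unfolding bq_norm_cofactor_def bq_norm_def bq_elt_times[OF assms] bq_elt_conj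
  by (cases s; cases t) (simp_all add: mult_ac)

lemma bq_norm_rat:
  assumes ab: "real_biquadratic a b"
  obtains N where "bq_norm a b q = of_rat N"
proof -
  obtain R0 R1 R2 R3 where R: "bq_times a b q (bq_norm_cofactor a b q) = (R0, R1, R2, R3)"
    by (metis prod_cases4)
  have e: "bq_elt a b s t (R0, R1, R2, R3) = bq_norm a b q" for s t
    using bq_elt_times_norm_cofactor[OF real_biquadratic_nonneg[OF ab], of s t q] R by simp
  have "(R0, R1, R2, R3) = bq_conj s t (R0, R1, R2, R3)" for s t
    using bq_elt_inject[OF ab, of False False] e bq_elt_conj_id by metis
  from this[of True False] this[of False True] have "R1 = 0" "R2 = 0" "R3 = 0"
    by (auto simp: bq_conj_def neg_if_def)
  then show ?thesis using e[of False False] by (intro that[of R0]) simp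
qed

lemma bq_inverse:
  assumes ab: "real_biquadratic a b" and nz: "bq_elt a b False False q \<noteq> 0"
  obtains r where "\<And>s t. bq_elt a b s t r = 1 / bq_elt a b s t q"
proof -
  note ab0 = real_biquadratic_nonneg[OF ab]
  obtain N where N: "bq_norm a b q = of_rat N" using bq_norm_rat[OF ab] by blast
  have nz': "bq_elt a b s t q \<noteq> 0" for s t using bq_elt_nonzero[OF ab nz] .
  then have "N \<noteq> 0" using N unfolding bq_norm_def by fastforce
  define r where "r = bq_times a b (1 / N, 0, 0, 0) (bq_norm_cofactor a b q)"
  have "bq_elt a b s t q * bq_elt a b s t r = 1" for s t
    using bq_elt_times_norm_cofactor[OF ab0, of s t q] N \<open>N \<noteq> 0\<close>
    unfolding r_def bq_elt_times[OF ab0] by (simp add: of_rat_divide mult_ac)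
  then show ?thesis using that nz' by (metis nonzero_eq_divide_eq mult.commute)
qed

lemma Ints_of_rat_iff: "(of_rat x :: real) \<in> \<int> \<longleftrightarrow> x \<in> \<int>"
  by (metis Ints_cases Ints_of_int of_rat_eq_iff of_rat_of_int_eq)

lemma rat_algebraic_int_Ints:
  assumes "algebraic_int (of_rat r :: real)"
  shows "r \<in> \<int>"
  using rational_algebraic_int_is_int[OF assms] Ints_of_rat_iff by auto

lemma bq_trace_Ints:
  assumes ab: "real_biquadratic a b" and h: "algebraic_int (bq_elt a b False False q)"
  shows "4 * fst q \<in> \<int>"
proof -
  obtain q0 q1 q2 q3 where q: "q = (q0, q1, q2, q3)" by (metis prod_cases4)
  have ai: "algebraic_int (bq_elt a b s t q)" for s t by (rule algebraic_int_bq_elt_conj[OF ab h])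
  have "bq_elt a b False False q + bq_elt a b False True q + bq_elt a b True False q + bq_elt a b True True q
      = of_rat (4 * q0)"
    unfolding q by (simp add: bq_elt_expand neg_if_def of_rat_mult of_rat_minus)
  moreover have "algebraic_int (bq_elt a b False False q + bq_elt a b False True q
                  + bq_elt a b True False q + bq_elt a b True True q)"
    by (intro algebraic_int_add ai)
  ultimately show ?thesis using rat_algebraic_int_Ints q by fastforce
qed

section \<open>Real quadratic fields and fundamental units\<close>

definition quad_times :: "int \<Rightarrow> rat \<times> rat \<Rightarrow> rat \<times> rat \<Rightarrow> rat \<times> rat" where
  "quad_times d p r = (fst p * fst r + of_int d * snd p * snd r, fst p * snd r + snd p * fst r)"

definition quad_cnj :: "rat \<times> rat \<Rightarrow> rat \<times> rat" where
  "quad_cnj p = (fst p, - snd p)"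

definition quad_inverse :: "int \<Rightarrow> rat \<times> rat \<Rightarrow> rat \<times> rat" where
  "quad_inverse d p = (fst p / quad_norm d p, - snd p / quad_norm d p)"

lemma quad_elt_times: "d \<ge> 0 \<Longrightarrow> quad_elt d (quad_times d p r) = quad_elt d p * quad_elt d r"
  unfolding quad_elt_def quad_times_def
  by (simp add: of_rat_add of_rat_mult algebra_simps flip: of_int_of_nat_eq)

lemma quad_elt_uminus [simp]: "quad_elt d (- p) = - quad_elt d p"
  by (simp add: quad_elt_def of_rat_minus)

lemma quad_elt_one [simp]: "quad_elt d (1, 0) = 1"
  by (simp add: quad_elt_def)

lemma quad_norm_eq: "d \<ge> 0 \<Longrightarrow> of_rat (quad_norm d p) = quad_elt d p * quad_elt d (quad_cnj p)"
  unfolding quad_elt_def quad_norm_def quad_cnj_def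
  by (simp add: of_rat_diff of_rat_mult of_rat_power of_rat_minus algebra_simps power2_eq_square)

lemma quad_norm_times: "quad_norm d (quad_times d p r) = quad_norm d p * quad_norm d r"
  unfolding quad_norm_def quad_times_def by (simp add: algebra_simps power2_eq_square)

lemma quad_norm_uminus [simp]: "quad_norm d (- p) = quad_norm d p"
  unfolding quad_norm_def by simp

lemma quad_norm_inverse:
  assumes "quad_norm d p \<noteq> 0"
  shows "quad_norm d (quad_inverse d p) = 1 / quad_norm d p"
proof -
  have "quad_norm d (quad_inverse d p) = quad_norm d p / (quad_norm d p)\<^sup>2"
    unfolding quad_inverse_def quad_norm_def by (simp add: power_divide diff_divide_distrib)
  then show ?thesis using assms by (simp add: power2_eq_square)
qed

lemma quad_elt_inject:
  assumes "squarefree d" "d > 1" "quad_elt d p = quad_elt d r"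
  shows "p = r"
proof -
  have "of_rat (fst p - fst r) + of_rat (snd p - snd r) * sqrt (of_int d) = 0"
    using assms(3) by (simp add: quad_elt_def of_rat_diff algebra_simps)
  from rat_plus_rat_sqrt_eq_0[OF assms(1,2) this] show ?thesis by (simp add: prod_eq_iff)
qed

lemma quad_norm_nonzero:
  assumes "squarefree d" "d > 1" "quad_elt d p \<noteq> 0"
  shows "quad_norm d p \<noteq> 0"
proof
  assume "quad_norm d p = 0"
  then have "quad_elt d (quad_cnj p) = quad_elt d (0, 0)"
    using quad_norm_eq[of d p] assms(2,3) by (simp add: quad_elt_def)
  then have "quad_cnj p = (0, 0)" by (rule quad_elt_inject[OF assms(1,2)])
  then show False using assms(3) by (simp add: quad_cnj_def quad_elt_def prod_eq_iff)
qed

lemma quad_elt_inverse: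
  assumes "squarefree d" "d > 1" "quad_elt d p \<noteq> 0"
  shows "quad_elt d (quad_inverse d p) = 1 / quad_elt d p"
proof -
  have N: "quad_norm d p \<noteq> 0" by (rule quad_norm_nonzero[OF assms])
  have "quad_elt d (quad_inverse d p) = quad_elt d (quad_cnj p) / of_rat (quad_norm d p)"
    unfolding quad_inverse_def quad_elt_def quad_cnj_def
    by (simp add: of_rat_divide of_rat_minus diff_divide_distrib)
  also have "\<dots> = 1 / quad_elt d p"
    using quad_norm_eq[of d p] assms N by (auto simp: field_simps)
  finally show ?thesis .
qed

text \<open>Embedding \<open>\<rat>(\<surd>d)\<close> into some biquadratic field transfers the conjugation results
  proved there.\<close>

lemma real_biquadratic_2_or_3:
  assumes "squarefree d" "d > 1"
  shows "real_biquadratic d (if d = 2 then 3 else 2)"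
proof -
  have "prime (3::int)"
    unfolding prime_int_iff'
  proof (intro conjI ballI)
    fix n :: int assume "n \<in> {2..<3}"
    then have "n = 2" by auto
    then show "\<not> n dvd 3" by simp
  qed simp
  then have "squarefree (2::int)" "squarefree (3::int)"
    by (simp_all add: squarefree_prime)
  then show ?thesis using assms unfolding real_biquadratic_def by auto
qed

lemma quad_elt_as_bq_elt: "quad_elt d (x, y) = bq_elt d b False False (x, y, 0, 0)"
  by (simp add: quad_elt_def bq_elt_expand neg_if_def)

lemma quad_elt_cnj_as_bq_elt: "quad_elt d (quad_cnj (x, y)) = bq_elt d b True False (x, y, 0, 0)"
  by (simp add: quad_elt_def bq_elt_expand neg_if_def quad_cnj_def of_rat_minus)

lemma algebraic_int_quad_cnj:
  assumes "squarefree d" "d > 1" "algebraic_int (quad_elt d p)"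
  shows "algebraic_int (quad_elt d (quad_cnj p))"
  using algebraic_int_bq_elt_conj[OF real_biquadratic_2_or_3[OF assms(1,2)]] assms(3)
  by (metis quad_elt_as_bq_elt quad_elt_cnj_as_bq_elt surj_pair)

lemma quad_unit_elt_nonzero: "p \<in> quad_units d \<Longrightarrow> quad_elt d p \<noteq> 0"
  by (simp add: quad_units_def)

lemma quad_unit_norm:
  assumes d: "squarefree d" "d > 1" and p: "p \<in> quad_units d"
  shows "quad_norm d p = 1 \<or> quad_norm d p = -1"
proof -
  have u0: "quad_elt d p \<noteq> 0" and ai: "algebraic_int (quad_elt d p)"
    and aii: "algebraic_int (quad_elt d (quad_inverse d p))"
    using p quad_elt_inverse[OF d] unfolding quad_units_def by auto
  have N0: "quad_norm d p \<noteq> 0" by (rule quad_norm_nonzero[OF d u0])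
  have "algebraic_int (of_rat (quad_norm d p) :: real)"
    using algebraic_int_mult[OF ai algebraic_int_quad_cnj[OF d ai]] quad_norm_eq[of d p] d by simp
  then obtain n where n: "quad_norm d p = of_int n" using rat_algebraic_int_Ints by (blast elim: Ints_cases)
  have "algebraic_int (of_rat (quad_norm d (quad_inverse d p)) :: real)"
    using algebraic_int_mult[OF aii algebraic_int_quad_cnj[OF d aii]] quad_norm_eq d by simp
  then obtain m where m: "1 / quad_norm d p = of_int m"
    using rat_algebraic_int_Ints quad_norm_inverse[OF N0] by (force elim: Ints_cases)
  have "of_int (n * m) = (1::rat)" using n m N0 by (simp add: field_simps)
  then have "n * m = 1" by (simp only: of_int_eq_1_iff)
  then have "n = 1 \<or> n = -1" using zmult_eq_1_iff by blast
  then show ?thesis using n by auto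
qed

text \<open>Via the trace \<open>2x\<close> and the square \<open>4dy\<^sup>2\<close> of \<open>2y\<surd>d\<close>.\<close>

lemma quad_unit_coords_half_Ints:
  assumes d: "squarefree d" "d > 1" and p: "p \<in> quad_units d"
  shows "2 * fst p \<in> \<int>" "2 * snd p \<in> \<int>"
proof -
  obtain x y where pxy: "p = (x, y)" by (cases p)
  have ai: "algebraic_int (quad_elt d p)" using p unfolding quad_units_def by auto
  have aic: "algebraic_int (quad_elt d (quad_cnj p))" by (rule algebraic_int_quad_cnj[OF d ai])
  have "quad_elt d p + quad_elt d (quad_cnj p) = of_rat (2 * x)"
    unfolding pxy quad_elt_def quad_cnj_def by (simp add: of_rat_minus of_rat_mult)
  then have "algebraic_int (of_rat (2 * x) :: real)" using algebraic_int_add[OF ai aic] by simp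
  then show "2 * fst p \<in> \<int>" using pxy rat_algebraic_int_Ints by simp
  define \<Delta> where "\<Delta> = quad_elt d p - quad_elt d (quad_cnj p)"
  have "algebraic_int \<Delta>"
    using algebraic_int_add[OF ai algebraic_int_minus[OF aic]] by (simp add: \<Delta>_def)
  note \<Delta> = algebraic_int_mult[OF this this]
  have "\<Delta> = of_rat (2 * y) * sqrt (of_int d)"
    unfolding \<Delta>_def pxy quad_elt_def quad_cnj_def by (simp add: of_rat_minus of_rat_mult)
  then have "\<Delta> * \<Delta> = of_rat (of_int d * (2 * y)\<^sup>2)"
    using d(2) by (simp add: of_rat_mult of_rat_power power2_eq_square algebra_simps)
  with \<Delta> have "algebraic_int (of_rat (of_int d * (2 * y)\<^sup>2) :: real)" by simp
  then have "of_int d * (2 * y)\<^sup>2 \<in> \<int>" by (rule rat_algebraic_int_Ints)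
  then have "2 * y \<in> \<int>" by (rule squarefree_times_rat_square_Ints[OF d(1)])
  then show "2 * snd p \<in> \<int>" using pxy by simp
qed

lemma quad_units_times:
  assumes "d \<ge> 0" "p \<in> quad_units d" "r \<in> quad_units d"
  shows "quad_times d p r \<in> quad_units d"
  using assms algebraic_int_mult[of "quad_elt d p" "quad_elt d r"]
    algebraic_int_mult[of "1 / quad_elt d p" "1 / quad_elt d r"]
  unfolding quad_units_def by (simp add: quad_elt_times)

lemma quad_units_inverse:
  assumes "squarefree d" "d > 1" "p \<in> quad_units d"
  shows "quad_inverse d p \<in> quad_units d"
  using assms quad_elt_inverse[OF assms(1,2)] unfolding quad_units_def by auto

lemma quad_units_uminus: "p \<in> quad_units d \<Longrightarrow> - p \<in> quad_units d"
  using algebraic_int_minus[of "1 / quad_elt d p"] unfolding quad_units_def by auto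

lemma quad_units_one: "(1, 0) \<in> quad_units d"
  unfolding quad_units_def by (auto intro: int_imp_algebraic_int)

primrec quad_power :: "int \<Rightarrow> rat \<times> rat \<Rightarrow> nat \<Rightarrow> rat \<times> rat" where
  "quad_power d p 0 = (1, 0)"
| "quad_power d p (Suc n) = quad_times d p (quad_power d p n)"

definition quad_power_int :: "int \<Rightarrow> rat \<times> rat \<Rightarrow> int \<Rightarrow> rat \<times> rat" where
  "quad_power_int d p k =
     (if k \<ge> 0 then quad_power d p (nat k) else quad_power d (quad_inverse d p) (nat (- k)))"

lemma quad_elt_power: "d \<ge> 0 \<Longrightarrow> quad_elt d (quad_power d p n) = quad_elt d p ^ n"
  by (induction n) (simp_all add: quad_elt_times)

lemma quad_norm_power: "quad_norm d (quad_power d p n) = quad_norm d p ^ n"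
  by (induction n) (simp_all add: quad_norm_def quad_norm_times[unfolded quad_norm_def])

lemma quad_units_power:
  "d \<ge> 0 \<Longrightarrow> p \<in> quad_units d \<Longrightarrow> quad_power d p n \<in> quad_units d"
  by (induction n) (simp_all add: quad_units_one quad_units_times)

lemma quad_elt_power_int:
  assumes "squarefree d" "d > 1" "quad_elt d p \<noteq> 0"
  shows "quad_elt d (quad_power_int d p k) = quad_elt d p powi k"
  using assms
  by (simp add: quad_power_int_def power_int_def quad_elt_power quad_elt_inverse inverse_eq_divide)

lemma quad_norm_power_int:
  assumes "quad_norm d p \<noteq> 0"
  shows "quad_norm d (quad_power_int d p k) = quad_norm d p powi k"
  using assms
  by (simp add: quad_power_int_def power_int_def quad_norm_power quad_norm_inverse inverse_eq_divide)

lemma quad_units_power_int: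
  assumes "squarefree d" "d > 1" "p \<in> quad_units d"
  shows "quad_power_int d p k \<in> quad_units d"
  using assms quad_units_power quad_units_inverse unfolding quad_power_int_def by simp

lemma quad_unit_gt_1_coords:
  assumes d: "squarefree d" "d > 1" and p: "p \<in> quad_units d" and big: "quad_elt d p > 1"
  shows "fst p > 0" "snd p > 0" "of_rat (fst p) \<le> quad_elt d p" "of_rat (snd p) \<le> quad_elt d p"
proof -
  obtain x y where pxy: "p = (x, y)" by (cases p)
  define u where "u = quad_elt d p"
  define u' where "u' = quad_elt d (quad_cnj p)"
  have "u * u' = 1 \<or> u * u' = -1"
    using quad_norm_eq[of d p] quad_unit_norm[OF d p] d unfolding u_def u'_def by auto
  then have "\<bar>u\<bar> * \<bar>u'\<bar> = 1" by (metis abs_minus_cancel abs_mult abs_one)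
  moreover have u1: "u > 1" using big unfolding u_def .
  ultimately have u': "\<bar>u'\<bar> < 1"
    by (metis abs_of_pos less_one mult_less_cancel_left2 not_less_iff_gr_or_eq zero_less_one
        order_less_trans mult.commute abs_ge_zero mult_le_cancel_left1 linorder_not_le)
  have sx: "u + u' = 2 * of_rat x" and sy: "u - u' = 2 * of_rat y * sqrt (of_int d)"
    unfolding u_def u'_def pxy quad_elt_def quad_cnj_def by (simp_all add: of_rat_minus)
  have sd: "sqrt (of_int d) \<ge> (1::real)" using d by simp
  have "of_rat x > (0::real)" using sx u' u1 by linarith
  then show "fst p > 0" using pxy by simp
  show "of_rat (fst p) \<le> quad_elt d p" using sx u' u1 pxy unfolding u_def by simp
  have "of_rat y * sqrt (of_int d) > (0::real)" using sy u' u1 by linarith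
  then have y: "of_rat y > (0::real)" using sd by (simp add: zero_less_mult_iff)
  then show "snd p > 0" using pxy by simp
  have "of_rat y \<le> of_rat y * sqrt (of_int d)" using y sd by (simp add: mult_le_cancel_left1)
  also have "\<dots> \<le> u" using sy u' u1 by linarith
  finally show "of_rat (snd p) \<le> quad_elt d p" using pxy unfolding u_def by simp
qed

lemma quad_unit_gt_1_exists:
  assumes d: "squarefree d" "d > 1" and p: "p \<in> quad_units d" "quad_norm d p = -1"
  obtains e where "e \<in> quad_units d" "quad_elt d e > 1"
proof -
  define u where "u = quad_elt d p"
  have u0: "u \<noteq> 0" using p unfolding quad_units_def u_def by auto
  have not1: "\<bar>u\<bar> \<noteq> 1"
  proof
    assume "\<bar>u\<bar> = 1"
    then have "u = 1 \<or> u = -1" by linarith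
    then have "quad_elt d p = quad_elt d (1, 0) \<or> quad_elt d p = quad_elt d (-1, 0)"
      unfolding u_def by (auto simp: quad_elt_def)
    then have "p = (1, 0) \<or> p = (-1, 0)" using quad_elt_inject[OF d] by blast
    then show False using p(2) by (auto simp: quad_norm_def)
  qed
  have inv: "quad_elt d (quad_inverse d p) = 1 / u"
    using quad_elt_inverse[OF d] u0 unfolding u_def by simp
  have U: "p \<in> quad_units d" "- p \<in> quad_units d" "quad_inverse d p \<in> quad_units d"
    "- quad_inverse d p \<in> quad_units d"
    using p(1) quad_units_uminus quad_units_inverse[OF d] by blast+
  consider "u > 1" | "u < -1" | "0 < u \<and> u < 1" | "-1 < u \<and> u < 0" using not1 u0 by linarith
  then show ?thesis
  proof cases
    case 1
    then show ?thesis using that U(1) u_def by blast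
  next
    case 2
    then show ?thesis using that[OF U(2)] u_def by simp
  next
    case 3
    then have "1 / u > 1" by simp
    then show ?thesis using that[OF U(3)] inv by simp
  next
    case 4
    then have "- (1 / u) > 1" by (simp add: field_simps)
    then show ?thesis using that[OF U(4)] inv by simp
  qed
qed

text \<open>Units in \<open>(1, E]\<close> have half-integral coordinates in \<open>(0, E]\<close>, so there are finitely many.\<close>

lemma quad_unit_gt_1_minimal:
  assumes d: "squarefree d" "d > 1" and E: "E \<in> quad_units d" "quad_elt d E > 1"
  obtains \<eta> where "\<eta> \<in> quad_units d" "quad_elt d \<eta> > 1"
    "\<And>p. p \<in> quad_units d \<Longrightarrow> quad_elt d p > 1 \<Longrightarrow> quad_elt d \<eta> \<le> quad_elt d p"
proof -
  define S where "S = {p \<in> quad_units d. 1 < quad_elt d p \<and> quad_elt d p \<le> quad_elt d E}"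
  define M where "M = \<lceil>2 * quad_elt d E\<rceil>"
  have "S \<subseteq> (\<lambda>(X, Y). (of_int X / 2, of_int Y / 2)) ` ({1..M} \<times> {1..M})"
  proof
    fix p assume "p \<in> S"
    then have pu: "p \<in> quad_units d" and p1: "quad_elt d p > 1" and pE: "quad_elt d p \<le> quad_elt d E"
      unfolding S_def by auto
    obtain X Y where X: "2 * fst p = of_int X" and Y: "2 * snd p = of_int Y"
      using quad_unit_coords_half_Ints[OF d pu] by (auto elim!: Ints_cases)
    note bounds = quad_unit_gt_1_coords[OF d pu p1]
    have "X > 0" "Y > 0"
      using bounds(1,2) X Y by (metis of_int_0_less_iff zero_less_mult_iff zero_less_numeral)+
    moreover have "real_of_int X = 2 * of_rat (fst p)" "real_of_int Y = 2 * of_rat (snd p)"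
      using X Y by (metis of_rat_mult of_rat_numeral_eq of_rat_of_int_eq)+
    then have "X \<le> M" "Y \<le> M" using bounds(3,4) pE unfolding M_def by linarith+
    ultimately have "1 \<le> X \<and> X \<le> M" "1 \<le> Y \<and> Y \<le> M" by auto
    moreover have "p = (of_int X / 2, of_int Y / 2)" using X Y by (cases p) (auto simp: field_simps)
    ultimately show "p \<in> (\<lambda>(X, Y). (of_int X / 2, of_int Y / 2)) ` ({1..M} \<times> {1..M})"
      by (intro image_eqI[of _ _ "(X, Y)"]) auto
  qed
  then have "finite S" by (rule finite_subset) auto
  moreover have ES: "E \<in> S" using E unfolding S_def by auto
  ultimately obtain \<eta> where "is_arg_min (quad_elt d) (\<lambda>p. p \<in> S) \<eta>"
    using ex_is_arg_min_if_finite by blast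
  then have \<eta>: "\<eta> \<in> S" "\<And>p. p \<in> S \<Longrightarrow> quad_elt d \<eta> \<le> quad_elt d p"
    by (auto simp: is_arg_min_linorder)
  show ?thesis
  proof (rule that)
    show "\<eta> \<in> quad_units d" "quad_elt d \<eta> > 1" using \<eta>(1) unfolding S_def by auto
    fix p assume "p \<in> quad_units d" "quad_elt d p > 1"
    then show "quad_elt d \<eta> \<le> quad_elt d p"
      using \<eta>(2)[of p] \<eta>(2)[OF ES] unfolding S_def by force
  qed
qed

text \<open>Dividing a positive unit by the largest power of \<open>\<eta>\<close> below it leaves a unit in \<open>[1, \<eta>)\<close>.\<close>

lemma quad_units_powers_of_minimal:
  assumes d: "squarefree d" "d > 1" and \<eta>: "\<eta> \<in> quad_units d" "quad_elt d \<eta> > 1"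
    and min: "\<And>p. p \<in> quad_units d \<Longrightarrow> quad_elt d p > 1 \<Longrightarrow> quad_elt d \<eta> \<le> quad_elt d p"
    and p: "p \<in> quad_units d"
  obtains k where "quad_elt d p = quad_elt d \<eta> powi k \<or> quad_elt d p = - (quad_elt d \<eta> powi k)"
proof -
  define e where "e = quad_elt d \<eta>"
  have e1: "e > 1" using \<eta> e_def by simp
  define p' where "p' = (if quad_elt d p > 0 then p else - p)"
  define v where "v = quad_elt d p'"
  have p': "p' \<in> quad_units d" unfolding p'_def using p quad_units_uminus by auto
  have v0: "v > 0" unfolding v_def p'_def using quad_unit_elt_nonzero[OF p] by auto
  have pv: "quad_elt d p = v \<or> quad_elt d p = - v" unfolding v_def p'_def by auto
  define k where "k = \<lfloor>log e v\<rfloor>"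
  have ek: "e powi k = e powr (real_of_int k)" using e1 by (simp add: powr_real_of_int')
  have lo: "e powr (real_of_int k) \<le> v"
    using e1 v0 powr_le_cancel_iff[of e "real_of_int k" "log e v"] unfolding k_def by simp
  have hi: "v < e * e powr (real_of_int k)"
  proof -
    have "v = e powr (log e v)" using e1 v0 by simp
    also have "\<dots> < e powr (real_of_int k + 1)" unfolding k_def using e1 by simp
    finally show ?thesis using e1 by (simp add: powr_add mult.commute)
  qed
  define t where "t = quad_times d p' (quad_power_int d \<eta> (- k))"
  have t: "t \<in> quad_units d"
    unfolding t_def using d by (intro quad_units_times quad_units_power_int p' \<eta>(1)) auto
  have "quad_elt d t = v * e powi (- k)"
    unfolding t_def v_def e_def using d \<eta> by (simp add: quad_elt_times quad_elt_power_int)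
  also have "\<dots> = v / e powr (real_of_int k)"
    using ek by (simp add: power_int_minus divide_inverse)
  finally have "quad_elt d t = v / e powr (real_of_int k)" .
  moreover have "e powr (real_of_int k) > 0" using e1 by simp
  ultimately have "1 \<le> quad_elt d t" "quad_elt d t < e"
    using lo hi by (simp_all add: divide_less_eq)
  then have "quad_elt d t = 1" using min[OF t] e_def by fastforce
  then have "v = e powi k" using \<open>quad_elt d t = v / e powr k\<close> ek \<open>e powr k > 0\<close> by simp
  then show ?thesis using pv e_def that by blast
qed

lemma quad_unit_power_int_cases:
  assumes d: "squarefree d" "d > 1" and \<eta>: "quad_elt d \<eta> \<noteq> 0"
    and "quad_elt d p = quad_elt d \<eta> powi k \<or> quad_elt d p = - (quad_elt d \<eta> powi k)"
  shows "p = quad_power_int d \<eta> k \<or> p = - quad_power_int d \<eta> k"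
  using assms quad_elt_power_int[OF d \<eta>] quad_elt_inject[OF d] by (metis quad_elt_uminus)

theorem fundamental_unit_norm_minus_1_exists:
  assumes d: "squarefree d" "d > 1" and p: "p \<in> quad_units d" "quad_norm d p = -1"
  obtains e where "fundamental_unit d e" "quad_norm d e = -1"
proof -
  obtain E where "E \<in> quad_units d" "quad_elt d E > 1"
    using quad_unit_gt_1_exists[OF d p] .
  then obtain \<eta> where \<eta>: "\<eta> \<in> quad_units d" "quad_elt d \<eta> > 1"
    and min: "\<And>p. p \<in> quad_units d \<Longrightarrow> quad_elt d p > 1 \<Longrightarrow> quad_elt d \<eta> \<le> quad_elt d p"
    using quad_unit_gt_1_minimal[OF d] by blast
  have "fundamental_unit d \<eta>"
    unfolding fundamental_unit_def using \<eta> quad_units_powers_of_minimal[OF d \<eta> min] by blast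
  moreover have "quad_norm d \<eta> = -1"
  proof (rule ccontr)
    assume "quad_norm d \<eta> \<noteq> -1"
    then have N: "quad_norm d \<eta> = 1" using quad_unit_norm[OF d \<eta>(1)] by blast
    obtain k where "p = quad_power_int d \<eta> k \<or> p = - quad_power_int d \<eta> k"
      using quad_units_powers_of_minimal[OF d \<eta> min p(1)] quad_unit_power_int_cases[OF d] \<eta>(2)
      by (metis not_one_less_zero)
    then have "quad_norm d p = 1" using quad_norm_power_int[of d \<eta> k] N by auto
    then show False using p(2) by simp
  qed
  ultimately show ?thesis using that by blast
qed

text \<open>Norm \<open>-1\<close> units are the odd powers of the fundamental unit, up to sign.\<close>

lemma norm_minus_1_units_times_square:
  assumes d: "squarefree d" "d > 1"
    and p: "p \<in> quad_units d" "quad_norm d p = -1" and r: "r \<in> quad_units d" "quad_norm d r = -1"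
  obtains w where "w \<in> quad_units d" "quad_times d p r = quad_times d w w \<or> quad_times d p r = - quad_times d w w"
proof -
  obtain \<eta> where fu: "fundamental_unit d \<eta>" and N: "quad_norm d \<eta> = -1"
    using fundamental_unit_norm_minus_1_exists[OF d p] by blast
  have \<eta>: "\<eta> \<in> quad_units d" "quad_elt d \<eta> \<noteq> 0"
    using fu unfolding fundamental_unit_def by auto
  have odd_power: "\<exists>k. odd k \<and> (x = quad_power_int d \<eta> k \<or> x = - quad_power_int d \<eta> k)"
    if x: "x \<in> quad_units d" "quad_norm d x = -1" for x
  proof -
    obtain k where k: "x = quad_power_int d \<eta> k \<or> x = - quad_power_int d \<eta> k"
      using fu x(1) quad_unit_power_int_cases[OF d \<eta>(2)] unfolding fundamental_unit_def by blast
    then have "(-1::rat) powi k = -1"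
      using x(2) N quad_norm_power_int[of d \<eta> k] by auto
    then have "odd k" by (cases "even k") (auto simp: power_int_minus_left)
    then show ?thesis using k by blast
  qed
  obtain i j where i: "odd i" "p = quad_power_int d \<eta> i \<or> p = - quad_power_int d \<eta> i"
    and j: "odd j" "r = quad_power_int d \<eta> j \<or> r = - quad_power_int d \<eta> j"
    using odd_power[OF p] odd_power[OF r] by blast
  define w where "w = quad_power_int d \<eta> ((i + j) div 2)"
  have "w \<in> quad_units d" unfolding w_def by (rule quad_units_power_int[OF d \<eta>(1)])
  moreover have "i + j = (i + j) div 2 + (i + j) div 2" using i(1) j(1) by presburger
  then have "quad_elt d \<eta> powi i * quad_elt d \<eta> powi j
      = quad_elt d \<eta> powi ((i + j) div 2) * quad_elt d \<eta> powi ((i + j) div 2)"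
    using \<eta>(2) by (metis power_int_add)
  then have "quad_elt d (quad_times d p r) = quad_elt d (quad_times d w w)
      \<or> quad_elt d (quad_times d p r) = quad_elt d (- quad_times d w w)"
    using i(2) j(2) d unfolding w_def by (auto simp: quad_elt_times quad_elt_power_int[OF d \<eta>(2)])
  ultimately show ?thesis using quad_elt_inject[OF d] that by blast
qed

lemma quad_unit_of_pell:
  assumes "d \<ge> 0" "y \<ge> 0" "of_int d * y\<^sup>2 = (of_int x)\<^sup>2 + 1"
  shows "(of_int x, y) \<in> quad_units d" "quad_norm d (of_int x, y) = -1"
proof -
  define s where "s = of_rat y * sqrt (of_int d :: real)"
  have s: "s \<ge> 0" "s\<^sup>2 = of_int x ^ 2 + 1"
  proof -
    show "s \<ge> 0" unfolding s_def using assms(1,2) by simp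
    have "s\<^sup>2 = of_rat (of_int d * y\<^sup>2)" unfolding s_def using assms(1)
      by (simp add: power_mult_distrib of_rat_mult of_rat_power)
    then show "s\<^sup>2 = of_int x ^ 2 + 1" using assms(3) by (simp add: of_rat_add of_rat_power)
  qed
  have e: "quad_elt d (of_int x, y) = of_int x + s" unfolding quad_elt_def s_def by simp
  have ne: "of_int x + s \<noteq> 0"
  proof
    assume "of_int x + s = 0"
    then have "s\<^sup>2 = (of_int x)\<^sup>2" by (simp add: eq_neg_iff_add_eq_0[symmetric])
    then show False using s(2) by simp
  qed
  have inv: "1 / (of_int x + s) = s - of_int x"
    using ne s(2) by (simp add: field_simps power2_eq_square)
  have "poly (map_poly of_int [:-1, -2*x, 1:]) (of_int x + s) = 0"
    "poly (map_poly of_int [:-1, 2*x, 1:]) (s - of_int x) = 0"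
    using s(2) by (simp_all add: algebra_simps power2_eq_square)
  moreover have "lead_coeff [:-1, -2*x, 1:] = 1" "lead_coeff [:-1, 2*x, 1:] = 1" by simp_all
  ultimately have "algebraic_int (of_int x + s)" "algebraic_int (1 / (of_int x + s))"
    unfolding inv algebraic_int_altdef_ipoly by blast+
  then show "(of_int x, y) \<in> quad_units d" unfolding quad_units_def mem_Collect_eq e using ne by simp
  show "quad_norm d (of_int x, y) = -1" using assms(3) by (simp add: quad_norm_def)
qed

lemma fundamental_unit_norm_minus_1_of_pell:
  fixes y :: rat
  assumes "squarefree d" "d > 1" "of_int d * y\<^sup>2 = (of_int x)\<^sup>2 + 1"
  obtains e where "fundamental_unit d e" "quad_norm d e = -1"
proof -
  have "of_int d * \<bar>y\<bar>\<^sup>2 = (of_int x)\<^sup>2 + 1" using assms(3) by simp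
  then have "(of_int x, \<bar>y\<bar>) \<in> quad_units d" "quad_norm d (of_int x, \<bar>y\<bar>) = -1"
    using quad_unit_of_pell[of d "\<bar>y\<bar>" x] assms(2) by simp_all
  then show ?thesis using fundamental_unit_norm_minus_1_exists[OF assms(1,2)] that by blast
qed

section \<open>Reduction modulo a prime\<close>

definition rat_cong :: "int \<Rightarrow> rat \<Rightarrow> int \<Rightarrow> bool" where
  "rat_cong p x c \<longleftrightarrow>
     (\<exists>n k. x = of_int n / of_int k \<and> k \<noteq> 0 \<and> coprime k p \<and> [n = c * k] (mod p))"

definition p_integral :: "int \<Rightarrow> rat \<Rightarrow> bool" where
  "p_integral p x \<longleftrightarrow> (\<exists>c. rat_cong p x c)"

lemma rat_cong_of_int: "rat_cong p (of_int n) n"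
  unfolding rat_cong_def by (intro exI[of _ n] exI[of _ 1]) auto

lemma rat_cong_add: "rat_cong p x c \<Longrightarrow> rat_cong p y e \<Longrightarrow> rat_cong p (x + y) (c + e)"
proof -
  assume "rat_cong p x c" "rat_cong p y e"
  then obtain n k n' k' where x: "x = of_int n / of_int k" "k \<noteq> 0" "coprime k p" "[n = c * k] (mod p)"
    and y: "y = of_int n' / of_int k'" "k' \<noteq> 0" "coprime k' p" "[n' = e * k'] (mod p)"
    unfolding rat_cong_def by blast
  have "x + y = of_int (n * k' + n' * k) / of_int (k * k')"
    using x(1,2) y(1,2) by (simp add: field_simps)
  moreover have "[n * k' + n' * k = c * k * k' + e * k' * k] (mod p)"
    using x(4) y(4) by (intro cong_add cong_mult cong_refl)
  then have "[n * k' + n' * k = (c + e) * (k * k')] (mod p)" by (simp add: algebra_simps)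
  ultimately show ?thesis
    using x(2,3) y(2,3) unfolding rat_cong_def by (intro exI[of _ "n * k' + n' * k"] exI[of _ "k * k'"]) auto
qed

lemma rat_cong_mult: "rat_cong p x c \<Longrightarrow> rat_cong p y e \<Longrightarrow> rat_cong p (x * y) (c * e)"
proof -
  assume "rat_cong p x c" "rat_cong p y e"
  then obtain n k n' k' where x: "x = of_int n / of_int k" "k \<noteq> 0" "coprime k p" "[n = c * k] (mod p)"
    and y: "y = of_int n' / of_int k'" "k' \<noteq> 0" "coprime k' p" "[n' = e * k'] (mod p)"
    unfolding rat_cong_def by blast
  have "[n * n' = (c * k) * (e * k')] (mod p)" using x(4) y(4) by (intro cong_mult)
  then have "[n * n' = (c * e) * (k * k')] (mod p)" by (simp add: algebra_simps)
  moreover have "x * y = of_int (n * n') / of_int (k * k')" using x(1) y(1) by simp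
  ultimately show ?thesis
    using x(2,3) y(2,3) unfolding rat_cong_def by (intro exI[of _ "n * n'"] exI[of _ "k * k'"]) auto
qed

lemma rat_cong_uminus: "rat_cong p x c \<Longrightarrow> rat_cong p (- x) (- c)"
  using rat_cong_mult[OF rat_cong_of_int[of p "-1"]] by fastforce

lemma rat_cong_cong:
  assumes "rat_cong p x c" "[c = e] (mod p)"
  shows "rat_cong p x e"
proof -
  obtain n k where x: "x = of_int n / of_int k" "k \<noteq> 0" "coprime k p" "[n = c * k] (mod p)"
    using assms(1) unfolding rat_cong_def by blast
  have "[c * k = e * k] (mod p)" using assms(2) by (intro cong_mult cong_refl)
  then have "[n = e * k] (mod p)" using x(4) cong_trans by blast
  then show ?thesis using x unfolding rat_cong_def by blast
qed

lemma rat_cong_unique: "rat_cong p x c \<Longrightarrow> rat_cong p x e \<Longrightarrow> [c = e] (mod p)"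
proof -
  assume "rat_cong p x c" "rat_cong p x e"
  then obtain n k n' k' where x: "x = of_int n / of_int k" "k \<noteq> 0" "coprime k p" "[n = c * k] (mod p)"
    and y: "x = of_int n' / of_int k'" "k' \<noteq> 0" "coprime k' p" "[n' = e * k'] (mod p)"
    unfolding rat_cong_def by blast
  have "of_int (n * k') = (of_int (n' * k) :: rat)" using x(1,2) y(1,2) by (simp add: field_simps)
  then have "n * k' = n' * k" by (simp only: of_int_eq_iff)
  moreover have "[n * k' = c * k * k'] (mod p)" "[n' * k = e * k' * k] (mod p)"
    using x(4) y(4) by (simp_all add: cong_scalar_right)
  ultimately have "[c * (k * k') = e * (k * k')] (mod p)"
    by (metis cong_sym cong_trans mult.assoc mult.commute)
  moreover have "coprime (k * k') p" using x(3) y(3) by simp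
  ultimately show ?thesis using cong_mult_rcancel by blast
qed

lemma rat_cong_multiple:
  assumes "rat_cong p x c" "p dvd k"
  shows "rat_cong p (of_int k * x) 0"
proof -
  have "rat_cong p (of_int k * x) (k * c)" by (rule rat_cong_mult[OF rat_cong_of_int assms(1)])
  moreover have "[k * c = 0] (mod p)" using assms(2) by (simp add: cong_0_iff)
  ultimately show ?thesis by (rule rat_cong_cong)
qed

lemma p_integral_frac:
  assumes "k \<noteq> 0" "coprime k p"
  shows "p_integral p (of_int n / of_int k)"
proof -
  obtain v where "[k * v = 1] (mod p)" using cong_solve_coprime_int[OF assms(2)] by blast
  then have "[n * (k * v) = n * 1] (mod p)" by (intro cong_mult cong_refl)
  then have "[n = (n * v) * k] (mod p)" by (simp add: algebra_simps cong_sym_eq)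
  then show ?thesis unfolding p_integral_def rat_cong_def using assms by blast
qed

lemma p_integral_half_Ints:
  assumes "coprime 2 p" "2 * x \<in> \<int>"
  shows "p_integral p x"
proof -
  obtain n where "2 * x = of_int n" using assms(2) by (rule Ints_cases)
  then have "x = of_int n / of_int 2" by (simp add: field_simps)
  moreover have "p_integral p (of_int n / of_int 2)" by (rule p_integral_frac[OF _ assms(1)]) simp
  ultimately show ?thesis by (simp only:)
qed

text \<open>Reduction of \<open>\<rat>(\<surd>a)\<close> modulo a prime \<open>p\<close> at which \<open>a\<close> is a square \<open>r\<^sup>2\<close>:
  \<open>x\<^sub>0 + x\<^sub>1\<surd>a \<mapsto> x\<^sub>0 + x\<^sub>1r\<close>.\<close>

definition quad_cong :: "int \<Rightarrow> int \<Rightarrow> rat \<times> rat \<Rightarrow> int \<Rightarrow> bool" where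
  "quad_cong p r x c \<longleftrightarrow>
     (\<exists>c0 c1. rat_cong p (fst x) c0 \<and> rat_cong p (snd x) c1 \<and> [c = c0 + c1 * r] (mod p))"

lemma quad_cong_intro: "rat_cong p x0 c0 \<Longrightarrow> rat_cong p x1 c1 \<Longrightarrow> quad_cong p r (x0, x1) (c0 + c1 * r)"
  unfolding quad_cong_def using cong_refl by fastforce

lemma quad_cong_exists:
  assumes "p_integral p (fst x)" "p_integral p (snd x)"
  obtains c where "quad_cong p r x c"
  using assms quad_cong_intro[of p "fst x" _ "snd x"] unfolding p_integral_def by (metis prod.collapse)

lemma quad_cong_cong:
  assumes "quad_cong p r x c" "[c = e] (mod p)"
  shows "quad_cong p r x e"
  using assms(1) cong_trans[OF cong_sym[OF assms(2)]] unfolding quad_cong_def by blast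

lemma quad_cong_unique:
  assumes "quad_cong p r x c" "quad_cong p r x e"
  shows "[c = e] (mod p)"
proof -
  obtain c0 c1 e0 e1 where c: "rat_cong p (fst x) c0" "rat_cong p (snd x) c1" "[c = c0 + c1 * r] (mod p)"
    and e: "rat_cong p (fst x) e0" "rat_cong p (snd x) e1" "[e = e0 + e1 * r] (mod p)"
    using assms unfolding quad_cong_def by blast
  have "[c0 + c1 * r = e0 + e1 * r] (mod p)"
    using rat_cong_unique[OF c(1) e(1)] rat_cong_unique[OF c(2) e(2)] by (intro cong_add cong_mult cong_refl)
  then show ?thesis using c(3) e(3) by (meson cong_sym cong_trans)
qed

lemma quad_cong_uminus:
  assumes "quad_cong p r x c"
  shows "quad_cong p r (- x) (- c)"
proof -
  obtain c0 c1 where c: "rat_cong p (fst x) c0" "rat_cong p (snd x) c1" "[c = c0 + c1 * r] (mod p)"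
    using assms unfolding quad_cong_def by blast
  have "[- c = - (c0 + c1 * r)] (mod p)" using c(3) by (rule cong_minus_minus_iff[THEN iffD2])
  then have "[- c = - c0 + - c1 * r] (mod p)" by simp
  then show ?thesis
    unfolding quad_cong_def fst_uminus snd_uminus using rat_cong_uminus[OF c(1)] rat_cong_uminus[OF c(2)] by blast
qed

lemma quad_cong_times:
  assumes r: "[r * r = a] (mod p)" and "quad_cong p r x c" "quad_cong p r y e"
  shows "quad_cong p r (quad_times a x y) (c * e)"
proof -
  obtain c0 c1 e0 e1 where x: "rat_cong p (fst x) c0" "rat_cong p (snd x) c1" "[c = c0 + c1 * r] (mod p)"
    and y: "rat_cong p (fst y) e0" "rat_cong p (snd y) e1" "[e = e0 + e1 * r] (mod p)"
    using assms(2,3) unfolding quad_cong_def by blast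
  have "rat_cong p (fst x * fst y + of_int a * snd x * snd y) (c0 * e0 + a * c1 * e1)"
    "rat_cong p (fst x * snd y + snd x * fst y) (c0 * e1 + c1 * e0)"
    by (intro rat_cong_add rat_cong_mult rat_cong_of_int x y)+
  moreover have "(c0 + c1 * r) * (e0 + e1 * r) - ((c0 * e0 + a * c1 * e1) + (c0 * e1 + c1 * e0) * r)
      = c1 * e1 * (r * r - a)"
    by (simp add: algebra_simps)
  then have "[(c0 + c1 * r) * (e0 + e1 * r) = (c0 * e0 + a * c1 * e1) + (c0 * e1 + c1 * e0) * r] (mod p)"
    using r by (simp add: cong_iff_dvd_diff)
  then have "[c * e = (c0 * e0 + a * c1 * e1) + (c0 * e1 + c1 * e0) * r] (mod p)"
    using cong_mult[OF x(3) y(3)] cong_trans by blast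
  ultimately show ?thesis unfolding quad_cong_def quad_times_def by auto
qed

section \<open>Units of positive norm\<close>

lemma bq_trace_times_Ints:
  assumes ab: "real_biquadratic a b"
    and "algebraic_int (bq_elt a b False False q)" "algebraic_int (bq_elt a b False False r)"
  shows "4 * fst (bq_times a b q r) \<in> \<int>"
proof -
  have "algebraic_int (bq_elt a b False False (bq_times a b q r))"
    using algebraic_int_mult[OF assms(2,3)] by (simp add: bq_elt_times[OF real_biquadratic_nonneg[OF ab]])
  then show ?thesis by (rule bq_trace_Ints[OF ab])
qed

lemma algebraic_int_bq_basis:
  assumes "a \<ge> 0" "b \<ge> 0"
  shows "algebraic_int (bq_elt a b False False (0, 1, 0, 0))"
    "algebraic_int (bq_elt a b False False (0, 0, 1, 0))"
    "algebraic_int (bq_elt a b False False (0, 0, 0, 1))"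
proof -
  have "algebraic_int (sqrt (of_int a) :: real)" "algebraic_int (sqrt (of_int b) :: real)"
    by (intro algebraic_int_sqrt int_imp_algebraic_int; simp)+
  then show "algebraic_int (bq_elt a b False False (0, 1, 0, 0))"
    "algebraic_int (bq_elt a b False False (0, 0, 1, 0))"
    "algebraic_int (bq_elt a b False False (0, 0, 0, 1))"
    using algebraic_int_mult by (simp_all add: bq_elt_expand neg_if_def)
qed

text \<open>The traces of \<open>q\<close>, \<open>q\<surd>a\<close>, \<open>q\<surd>b\<close>, \<open>q\<surd>ab\<close>, \<open>q\<^sup>2\<close> and \<open>q\<^sup>2\<surd>a\<close> are integers.\<close>

lemma algebraic_int_bq_coords:
  assumes ab: "real_biquadratic a b" and q: "algebraic_int (bq_elt a b False False (q0, q1, q2, q3))"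
  obtains T0 T1 T2 T3 where "q0 = of_int T0 / 4" "q1 = of_int T1 / (4 * of_int a)"
    "q2 = of_int T2 / (4 * of_int b)" "q3 = of_int T3 / (4 * of_int a * of_int b)"
    "b dvd a * T2\<^sup>2 + T3\<^sup>2" "b dvd T2 * T3"
proof -
  have a: "a > 1" and b: "b > 1" using ab unfolding real_biquadratic_def by auto
  note e = algebraic_int_bq_basis[OF real_biquadratic_nonneg[OF ab]]
  let ?q = "(q0, q1, q2, q3)"
  have sq: "algebraic_int (bq_elt a b False False (bq_times a b ?q ?q))"
    using algebraic_int_mult[OF q q] by (simp add: bq_elt_times[OF real_biquadratic_nonneg[OF ab]])
  have "4 * q0 \<in> \<int>" using bq_trace_Ints[OF ab q] by simp
  moreover have "4 * (of_int a * q1) \<in> \<int>" "4 * (of_int b * q2) \<in> \<int>"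
    "4 * (of_int a * of_int b * q3) \<in> \<int>"
    using bq_trace_times_Ints[OF ab q e(1)] bq_trace_times_Ints[OF ab q e(2)]
      bq_trace_times_Ints[OF ab q e(3)] by (simp_all add: bq_times_def)
  moreover have "4 * (q0*q0 + of_int a*q1*q1 + of_int b*q2*q2 + of_int a * of_int b*q3*q3) \<in> \<int>"
    using bq_trace_Ints[OF ab sq] by (simp add: bq_times_def)
  moreover have "4 * (of_int a * (q0*q1 + q1*q0 + of_int b*(q2*q3 + q3*q2))) \<in> \<int>"
    using bq_trace_times_Ints[OF ab sq e(1)] by (simp add: bq_times_def)
  ultimately obtain T0 T1 T2 T3 K V where
    T0: "4 * q0 = of_int T0" and T1: "4 * (of_int a * q1) = of_int T1"
    and T2: "4 * (of_int b * q2) = of_int T2" and T3: "4 * (of_int a * of_int b * q3) = of_int T3"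
    and K: "4 * (q0*q0 + of_int a*q1*q1 + of_int b*q2*q2 + of_int a * of_int b*q3*q3) = of_int K"
    and V: "4 * (of_int a * (q0*q1 + q1*q0 + of_int b*(q2*q3 + q3*q2))) = of_int V"
    by (elim Ints_cases) blast
  have an: "(of_int a :: rat) \<noteq> 0" "(of_int b :: rat) \<noteq> 0" using a b by auto
  have qq: "q0 = of_int T0 / 4" "q1 = of_int T1 / (4 * of_int a)" "q2 = of_int T2 / (4 * of_int b)"
    "q3 = of_int T3 / (4 * of_int a * of_int b)"
    using T0 T1 T2 T3 an by (auto simp: field_simps)
  have "of_int (a*b*T0\<^sup>2 + b*T1\<^sup>2 + a*T2\<^sup>2 + T3\<^sup>2) = (of_int (4*a*b*K) :: rat)"
    using K an unfolding qq by (simp add: field_simps power2_eq_square)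
  then have "a * T2\<^sup>2 + T3\<^sup>2 = b * (4*a*K - a*T0\<^sup>2 - T1\<^sup>2)"
    by (simp only: of_int_eq_iff) (simp add: algebra_simps)
  moreover have "of_int (4*a*(b*T0*T1 + T2*T3)) = (of_int (4*a*(2*b*V)) :: rat)"
    using V an unfolding qq by (simp add: field_simps power2_eq_square)
  then have "4*a*(b*T0*T1 + T2*T3) = 4*a*(2*b*V)" by (simp only: of_int_eq_iff)
  then have "b*T0*T1 + T2*T3 = 2*b*V" using a by simp
  then have "T2 * T3 = b * (2*V - T0*T1)" by (simp add: algebra_simps)
  ultimately show ?thesis using qq that by (metis dvd_triv_left)
qed

lemma prime_dvd_both_if_dvd_norm_form:
  fixes p a x y :: int
  assumes p: "prime p" "\<not> p dvd a" and xy: "p dvd a * x\<^sup>2 + y\<^sup>2" "p dvd x * y"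
  shows "p dvd x \<and> p dvd y"
proof (cases "p dvd x")
  case True
  then have "p dvd a * x\<^sup>2" by (simp add: power2_eq_square)
  then have "p dvd y\<^sup>2" using xy(1) by (simp add: dvd_add_right_iff)
  then show ?thesis using True p(1) prime_dvd_power by blast
next
  case False
  then have "p dvd y" using xy(2) p(1) prime_dvd_mult_iff by blast
  then have "p dvd y\<^sup>2" by (simp add: power2_eq_square)
  then have "p dvd a * x\<^sup>2" using xy(1) by (simp add: dvd_add_left_iff)
  then have "p dvd x\<^sup>2" using p prime_dvd_mult_iff by blast
  then show ?thesis using False p(1) prime_dvd_power by blast
qed

lemma algebraic_int_bq_coords_p_integral:
  assumes ab: "real_biquadratic a b" and p: "prime p" "odd p" "p dvd b" "\<not> p dvd a"
    and q: "algebraic_int (bq_elt a b False False (q0, q1, q2, q3))"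
  shows "p_integral p q0" "p_integral p q1" "p_integral p q2" "p_integral p q3"
proof -
  have b: "squarefree b" and a0: "a \<noteq> 0" using ab unfolding real_biquadratic_def by auto
  obtain T0 T1 T2 T3 where qq: "q0 = of_int T0 / 4" "q1 = of_int T1 / (4 * of_int a)"
    "q2 = of_int T2 / (4 * of_int b)" "q3 = of_int T3 / (4 * of_int a * of_int b)"
    and T: "b dvd a * T2\<^sup>2 + T3\<^sup>2" "b dvd T2 * T3"
    using algebraic_int_bq_coords[OF ab q] by blast
  have "p dvd T2 \<and> p dvd T3"
    using prime_dvd_both_if_dvd_norm_form[OF p(1,4)] dvd_trans[OF p(3) T(1)] dvd_trans[OF p(3) T(2)] by blast
  then obtain t2 t3 where t: "T2 = p * t2" "T3 = p * t3" by (auto elim!: dvdE)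
  obtain b0 where b0: "b = p * b0" using p(3) by blast
  have nb0: "\<not> p dvd b0"
  proof
    assume "p dvd b0"
    then have "p * p dvd b" using b0 by simp
    then have "is_unit p" using b squarefreeD[of b p] by (simp add: power2_eq_square)
    then show False using p(1) not_prime_unit by blast
  qed
  have p0: "p \<noteq> 0" and b00: "b0 \<noteq> 0" using p(1) ab b0 unfolding real_biquadratic_def by auto
  have cop: "coprime x p" if "\<not> p dvd x" for x
    using p(1) that by (simp add: prime_imp_coprime coprime_commute)
  have "coprime 4 p"
    using p(2) by (metis coprime_left_2_iff_odd coprime_power_left_iff power2_eq_square mult_2 numeral_Bit0
        numeral_One one_add_one zero_less_numeral)
  then have c: "coprime (4 * a) p" "coprime (4 * b0) p" "coprime (4 * b0 * a) p"
    using cop[OF p(4)] cop[OF nb0] by simp_all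
  have q23: "q2 = of_int t2 / of_int (4 * b0)" "q3 = of_int t3 / of_int (4 * b0 * a)"
    using p0 unfolding qq t b0 by (simp_all add: field_simps)
  show "p_integral p q0" unfolding qq(1) using p_integral_frac[of 4 p T0] \<open>coprime 4 p\<close> by simp
  show "p_integral p q1" unfolding qq(2) using p_integral_frac[of "4 * a" p T1] c(1) a0 by simp
  show "p_integral p q2" unfolding q23(1) using p_integral_frac[of "4 * b0" p t2] c(2) b00 by simp
  show "p_integral p q3" unfolding q23(2) using p_integral_frac[of "4 * b0 * a" p t3] c(3) a0 b00 by simp
qed

text \<open>The relative norm \<open>q \<cdot> \<sigma>(q)\<close> to \<open>\<rat>(\<surd>a)\<close>, where \<open>\<sigma>\<close> negates \<open>\<surd>b\<close>.\<close>

definition bq_rel_norm :: "int \<Rightarrow> int \<Rightarrow> rat \<times> rat \<times> rat \<times> rat \<Rightarrow> rat \<times> rat" where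
  "bq_rel_norm a b q = (case q of (q0, q1, q2, q3) \<Rightarrow>
     (q0 * q0 + of_int a * q1 * q1 - of_int b * q2 * q2 - of_int a * of_int b * q3 * q3,
      2 * q0 * q1 - 2 * of_int b * q2 * q3))"

lemma bq_times_conj_b: "bq_times a b q (bq_conj False True q) = (fst (bq_rel_norm a b q), snd (bq_rel_norm a b q), 0, 0)"
  by (cases q) (simp add: bq_times_def bq_conj_def bq_rel_norm_def neg_if_def algebra_simps)

lemma quad_elt_bq_rel_norm:
  assumes "a \<ge> 0" "b \<ge> 0"
  shows "quad_elt a (bq_rel_norm a b q) = bq_elt a b False False q * bq_elt a b False True q"
    "quad_elt a (quad_cnj (bq_rel_norm a b q)) = bq_elt a b True False q * bq_elt a b True True q"
proof -
  obtain x y where xy: "bq_rel_norm a b q = (x, y)" by (cases "bq_rel_norm a b q")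
  have "bq_elt a b s t (x, y, 0, 0) = bq_elt a b s t q * bq_elt a b s (\<not> t) q" for s t
    using bq_elt_times[OF assms, of s t q "bq_conj False True q"] bq_times_conj_b[of a b q] xy
    by (simp add: bq_elt_conj)
  then show "quad_elt a (bq_rel_norm a b q) = bq_elt a b False False q * bq_elt a b False True q"
    "quad_elt a (quad_cnj (bq_rel_norm a b q)) = bq_elt a b True False q * bq_elt a b True True q"
    unfolding xy quad_elt_as_bq_elt[of a _ _ b] quad_elt_cnj_as_bq_elt[of a _ _ b] by simp_all
qed

lemma quad_norm_bq_rel_norm:
  assumes "a \<ge> 0" "b \<ge> 0"
  shows "of_rat (quad_norm a (bq_rel_norm a b q)) = bq_norm a b q"
  using quad_norm_eq[OF assms(1)] quad_elt_bq_rel_norm[OF assms] by (simp add: bq_norm_def mult_ac)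

lemma bq_rel_norm_unit:
  assumes ab: "real_biquadratic a b" and q: "q \<in> bq_units a b"
  shows "bq_rel_norm a b q \<in> quad_units a"
proof -
  note ab0 = real_biquadratic_nonneg[OF ab]
  have q0: "bq_elt a b False False q \<noteq> 0"
    and ai: "algebraic_int (bq_elt a b False False q)" and aii: "algebraic_int (1 / bq_elt a b False False q)"
    using q unfolding bq_units_def by auto
  obtain r where r: "\<And>s t. bq_elt a b s t r = 1 / bq_elt a b s t q" using bq_inverse[OF ab q0] by blast
  have "algebraic_int (bq_elt a b s t q)" "algebraic_int (1 / bq_elt a b s t q)" for s t
    using algebraic_int_bq_elt_conj[OF ab ai] algebraic_int_bq_elt_conj[OF ab, of False False r] aii r
    by simp_all
  note u = this
  have "algebraic_int (bq_elt a b False False q * bq_elt a b False True q)"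
    "algebraic_int (1 / bq_elt a b False False q * (1 / bq_elt a b False True q))"
    using algebraic_int_mult[OF u(1) u(1)] algebraic_int_mult[OF u(2) u(2)] by blast+
  then show ?thesis
    unfolding quad_units_def using bq_elt_nonzero[OF ab q0]
    by (simp add: quad_elt_bq_rel_norm(1)[OF ab0])
qed

lemma quad_cong_bq_rel_norm:
  assumes r: "[r * r = a] (mod p)" and "p dvd b"
    and q: "rat_cong p q0 c0" "rat_cong p q1 c1" "p_integral p q2" "p_integral p q3"
  shows "quad_cong p r (bq_rel_norm a b (q0, q1, q2, q3)) ((c0 + c1 * r) * (c0 + c1 * r))"
proof -
  obtain c2 c3 where c: "rat_cong p q2 c2" "rat_cong p q3 c3" using q(3,4) unfolding p_integral_def by blast
  have "rat_cong p (q2 * q2) (c2 * c2)" "rat_cong p (q3 * q3) (c3 * c3)" "rat_cong p (q2 * q3) (c2 * c3)"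
    using rat_cong_mult c by blast+
  moreover have "p dvd - b" "p dvd - (a * b)" "p dvd - (2 * b)" using \<open>p dvd b\<close> by simp_all
  ultimately have "rat_cong p (of_int (- b) * (q2 * q2)) 0" "rat_cong p (of_int (- (a * b)) * (q3 * q3)) 0"
    "rat_cong p (of_int (- (2 * b)) * (q2 * q3)) 0"
    by (blast intro: rat_cong_multiple)+
  then have "rat_cong p (q0 * q0 + of_int a * (q1 * q1) + of_int (- b) * (q2 * q2) + of_int (- (a * b)) * (q3 * q3))
      (c0 * c0 + a * (c1 * c1) + 0 + 0)"
    "rat_cong p (of_int 2 * (q0 * q1) + of_int (- (2 * b)) * (q2 * q3)) (2 * (c0 * c1) + 0)"
    using q(1,2) by (blast intro: rat_cong_add rat_cong_mult rat_cong_of_int)+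
  then have "quad_cong p r
      (q0 * q0 + of_int a * (q1 * q1) + of_int (- b) * (q2 * q2) + of_int (- (a * b)) * (q3 * q3),
       of_int 2 * (q0 * q1) + of_int (- (2 * b)) * (q2 * q3))
      ((c0 * c0 + a * (c1 * c1) + 0 + 0) + (2 * (c0 * c1) + 0) * r)"
    by (rule quad_cong_intro)
  moreover have "(q0 * q0 + of_int a * (q1 * q1) + of_int (- b) * (q2 * q2) + of_int (- (a * b)) * (q3 * q3),
       of_int 2 * (q0 * q1) + of_int (- (2 * b)) * (q2 * q3)) = bq_rel_norm a b (q0, q1, q2, q3)"
    by (simp add: bq_rel_norm_def algebra_simps)
  ultimately have "quad_cong p r (bq_rel_norm a b (q0, q1, q2, q3)) ((c0 * c0 + a * (c1 * c1)) + (2 * (c0 * c1)) * r)"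
    by simp
  moreover have "[(c0 * c0 + a * (c1 * c1)) + (2 * (c0 * c1)) * r = (c0 + c1 * r) * (c0 + c1 * r)] (mod p)"
  proof -
    have "(c0 + c1 * r) * (c0 + c1 * r) - ((c0 * c0 + a * (c1 * c1)) + (2 * (c0 * c1)) * r) = c1 * c1 * (r * r - a)"
      by (simp add: algebra_simps)
    then have "[(c0 + c1 * r) * (c0 + c1 * r) = (c0 * c0 + a * (c1 * c1)) + (2 * (c0 * c1)) * r] (mod p)"
      using r by (simp add: cong_iff_dvd_diff)
    then show ?thesis by (rule cong_sym)
  qed
  ultimately show ?thesis by (rule quad_cong_cong)
qed

lemma cong_square_if_cong_pm_square:
  fixes p i P G W :: int
  assumes p: "prime p" and i: "[i * i = -1] (mod p)" and W: "\<not> p dvd W"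
    and PW: "[W * W = P * P * G] (mod p) \<or> [- (W * W) = P * P * G] (mod p)"
  obtains z where "[z * z = G] (mod p)"
proof -
  have "\<not> p dvd P"
  proof
    assume "p dvd P"
    then have "[P * P * G = 0] (mod p)" by (simp add: cong_0_iff)
    then have "[W * W = 0] (mod p) \<or> [- (W * W) = 0] (mod p)" using PW cong_trans by blast
    then have "p dvd W * W" by (auto simp: cong_0_iff)
    then show False using W p prime_dvd_mult_iff by blast
  qed
  then have "coprime P p" using prime_imp_coprime[OF p] by (simp add: coprime_commute)
  then obtain Pi where Pi: "[P * Pi = 1] (mod p)" using cong_solve_coprime_int by blast
  have "[G * (P * Pi) * (P * Pi) = G * 1 * 1] (mod p)" using Pi by (intro cong_mult cong_refl)
  then have PG: "[P * P * G * (Pi * Pi) = G] (mod p)" by (simp add: mult_ac)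
  from PW show ?thesis
  proof
    assume "[W * W = P * P * G] (mod p)"
    then have "[W * W * (Pi * Pi) = P * P * G * (Pi * Pi)] (mod p)" by (rule cong_scalar_right)
    then have "[W * W * (Pi * Pi) = G] (mod p)" using PG by (rule cong_trans)
    then have "[(W * Pi) * (W * Pi) = G] (mod p)" by (simp add: mult_ac)
    then show ?thesis by (rule that)
  next
    assume "[- (W * W) = P * P * G] (mod p)"
    have "[(i * i) * (W * W) = -1 * (W * W)] (mod p)" using i by (rule cong_scalar_right)
    then have "[(i * i) * (W * W) = P * P * G] (mod p)"
      using \<open>[- (W * W) = P * P * G] (mod p)\<close> by (simp add: cong_trans)
    then have "[(i * i) * (W * W) * (Pi * Pi) = P * P * G * (Pi * Pi)] (mod p)" by (rule cong_scalar_right)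
    then have "[(i * i) * (W * W) * (Pi * Pi) = G] (mod p)" using PG by (rule cong_trans)
    then have "[(i * W * Pi) * (i * W * Pi) = G] (mod p)" by (simp add: mult_ac)
    then show ?thesis by (rule that)
  qed
qed

lemma quad_unit_quad_cong_exists:
  assumes "squarefree a" "a > 1" "odd p" "w \<in> quad_units a"
  obtains W where "quad_cong p r w W"
proof -
  have "coprime 2 p" using assms(3) by simp
  then have "p_integral p (fst w)" "p_integral p (snd w)"
    using p_integral_half_Ints quad_unit_coords_half_Ints[OF assms(1,2,4)] by blast+
  then show ?thesis using quad_cong_exists that by blast
qed

lemma quad_unit_quad_cong_not_dvd:
  assumes a: "squarefree a" "a > 1" and p: "prime p" "odd p" and r: "[r * r = a] (mod p)"
    and w: "w \<in> quad_units a" "quad_cong p r w W"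
  shows "\<not> p dvd W"
proof
  assume "p dvd W"
  obtain W' where W': "quad_cong p r (quad_inverse a w) W'"
    using quad_unit_quad_cong_exists[OF a p(2) quad_units_inverse[OF a w(1)]] .
  have "quad_elt a (quad_times a w (quad_inverse a w)) = quad_elt a (1, 0)"
    using quad_elt_inverse[OF a quad_unit_elt_nonzero[OF w(1)]] quad_unit_elt_nonzero[OF w(1)] a(2)
    by (simp add: quad_elt_times)
  then have inv: "quad_times a w (quad_inverse a w) = (1, 0)" by (rule quad_elt_inject[OF a])
  have one: "quad_cong p r (1, 0) 1"
    using quad_cong_intro[OF rat_cong_of_int[of p 1] rat_cong_of_int[of p 0], of r] by simp
  have "quad_cong p r (quad_times a w (quad_inverse a w)) (W * W')" by (rule quad_cong_times[OF r w(2) W'])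
  then have "[W * W' = 1] (mod p)" unfolding inv using one by (rule quad_cong_unique)
  moreover have "[W * W' = 0] (mod p)" using \<open>p dvd W\<close> by (simp add: cong_0_iff)
  ultimately have "p dvd 1" using cong_trans[OF cong_sym] by (metis cong_0_iff)
  then show False using p(1) not_prime_unit by blast
qed

text \<open>If \<open>N(q) < 0\<close>, the relative norm \<open>\<alpha>\<close> of \<open>q\<close> to \<open>\<rat>(\<surd>a)\<close> has norm \<open>-1\<close>, so \<open>\<alpha>\<epsilon> = \<plusminus>w\<^sup>2\<close>.
  Modulo \<open>p\<close> the conjugation of \<open>\<surd>b\<close> is trivial, hence \<open>\<alpha> \<equiv> P\<^sup>2\<close>, and \<open>\<epsilon>\<close> would reduce to a
  square.\<close>

theorem bq_units_norm_pos:
  assumes ab: "real_biquadratic a b"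
    and p: "prime p" "odd p" "p dvd b" "\<not> p dvd a"
    and r: "[r * r = a] (mod p)" and i: "[i * i = -1] (mod p)"
    and \<epsilon>: "\<epsilon> \<in> quad_units a" "quad_norm a \<epsilon> = -1" "quad_cong p r \<epsilon> G"
    and G: "\<And>z. \<not> [z * z = G] (mod p)"
    and q: "q \<in> bq_units a b"
  shows "bq_norm a b q > 0"
proof (rule ccontr)
  assume "\<not> bq_norm a b q > 0"
  obtain q0 q1 q2 q3 where qq: "q = (q0, q1, q2, q3)" by (metis prod_cases4)
  have a: "squarefree a" "a > 1" using ab unfolding real_biquadratic_def by auto
  have q0: "bq_elt a b False False q \<noteq> 0" and ai: "algebraic_int (bq_elt a b False False q)"
    using q unfolding bq_units_def by auto
  define \<alpha> where "\<alpha> = bq_rel_norm a b q"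
  have \<alpha>: "\<alpha> \<in> quad_units a" unfolding \<alpha>_def by (rule bq_rel_norm_unit[OF ab q])
  have "bq_norm a b q \<noteq> 0" using bq_elt_nonzero[OF ab q0] unfolding bq_norm_def by simp
  then have "of_rat (quad_norm a \<alpha>) < (0::real)"
    using \<open>\<not> bq_norm a b q > 0\<close> quad_norm_bq_rel_norm[OF real_biquadratic_nonneg[OF ab], of q]
    unfolding \<alpha>_def by linarith
  then have "quad_norm a \<alpha> = -1" using quad_unit_norm[OF a \<alpha>] by auto
  then obtain w where w: "w \<in> quad_units a"
    and w_eq: "quad_times a \<alpha> \<epsilon> = quad_times a w w \<or> quad_times a \<alpha> \<epsilon> = - quad_times a w w"
    using norm_minus_1_units_times_square[OF a \<alpha> _ \<epsilon>(1,2)] by blast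
  have pq: "p_integral p q0" "p_integral p q1" "p_integral p q2" "p_integral p q3"
    using algebraic_int_bq_coords_p_integral[OF ab p] ai unfolding qq by auto
  then obtain c0 c1 where c: "rat_cong p q0 c0" "rat_cong p q1 c1" unfolding p_integral_def by blast
  define P where "P = c0 + c1 * r"
  have \<alpha>\<epsilon>: "quad_cong p r (quad_times a \<alpha> \<epsilon>) (P * P * G)"
    unfolding \<alpha>_def qq P_def using quad_cong_bq_rel_norm[OF r p(3) c pq(3,4)]
    by (intro quad_cong_times[OF r] \<epsilon>(3))
  obtain W where W: "quad_cong p r w W" using quad_unit_quad_cong_exists[OF a p(2) w] .
  note ww = quad_cong_times[OF r W W]
  have "[W * W = P * P * G] (mod p) \<or> [- (W * W) = P * P * G] (mod p)"
    using w_eq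
  proof
    assume "quad_times a \<alpha> \<epsilon> = quad_times a w w"
    then show ?thesis using quad_cong_unique[OF ww] \<alpha>\<epsilon> by simp
  next
    assume "quad_times a \<alpha> \<epsilon> = - quad_times a w w"
    then show ?thesis using quad_cong_unique[OF quad_cong_uminus[OF ww]] \<alpha>\<epsilon> by simp
  qed
  then obtain z where "[z * z = G] (mod p)"
    using cong_square_if_cong_pm_square[OF p(1) i quad_unit_quad_cong_not_dvd[OF a p(1,2) r w W]] by blast
  then show False using G by blast
qed

section \<open>Square roots in a biquadratic field\<close>

lemma sqrt_in_biquad_field_cases:
  assumes ab: "real_biquadratic a b" and d: "d > 1" "squarefree d"
    and h: "sqrt (of_int d) \<in> biquad_field a b"
  shows "d = a \<or> d = b \<or> (\<exists>z::rat. of_int d = z\<^sup>2 * of_int a * of_int b)"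
proof -
  have a: "a > 1" "squarefree a" and b: "b > 1" "squarefree b"
    using ab unfolding real_biquadratic_def by auto
  obtain q where sq: "sqrt (of_int d) = bq_elt a b False False q"
    using h unfolding biquad_field_def by blast
  obtain q0 q1 q2 q3 where qq: "q = (q0, q1, q2, q3)" by (metis prod_cases4)
  have "bq_elt a b False False (bq_times a b q q) = bq_elt a b False False (of_int d, 0, 0, 0)"
    unfolding bq_elt_times[OF real_biquadratic_nonneg[OF ab]] sq[symmetric] using d by simp
  then have "bq_times a b q q = (of_int d, 0, 0, 0)" by (rule bq_elt_inject[OF ab])
  then have E0: "q0*q0 + of_int a*q1*q1 + of_int b*q2*q2 + of_int a * of_int b*q3*q3 = of_int d"
    and E1: "q0*q1 + of_int b * (q2*q3) = 0" and E2: "q0*q2 + of_int a * (q1*q3) = 0"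
    and E3: "q0*q3 + q1*q2 = 0"
    unfolding qq bq_times_def by (auto simp: algebra_simps)
  have an: "(of_int a :: rat) \<noteq> 0" "(of_int b :: rat) \<noteq> 0" using a b by auto
  show ?thesis
  proof (cases "q0 = 0")
    case False
    have "q1 * (q0*q0 - of_int b * q2*q2) = q0 * (q0*q1 + of_int b * (q2*q3)) - of_int b * q2 * (q0*q3 + q1*q2)"
      by (simp add: algebra_simps)
    then have "q1 * (q0*q0 - of_int b * q2*q2) = 0" using E1 E3 by simp
    moreover have "q0*q0 \<noteq> of_int b * q2*q2"
    proof
      assume "q0*q0 = of_int b * q2*q2"
      moreover have "q2 \<noteq> 0" using False calculation by auto
      ultimately have "(q0/q2)\<^sup>2 = of_int b" by (simp add: field_simps power2_eq_square)
      then show False using squarefree_not_rat_square[OF b(2) b(1)] by blast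
    qed
    ultimately have "q1 = 0" by simp
    then have "q3 = 0" "q2 = 0" using E2 E3 False by simp_all
    then have "sqrt (of_int d) = of_rat q0" using sq \<open>q1 = 0\<close> unfolding qq by simp
    then show ?thesis using sqrt_squarefree_not_rat[OF d(2) d(1)] by blast
  next
    case True
    have "q1 * q2 = 0" "q2 * q3 = 0" "q1 * q3 = 0"
      using E1 E2 E3 True an by simp_all
    then
    consider "q1 \<noteq> 0" "q2 = 0" "q3 = 0" | "q1 = 0" "q2 \<noteq> 0" "q3 = 0" | "q1 = 0" "q2 = 0"
      by auto
    then show ?thesis
    proof cases
      case 1
      then have "of_int a * q1\<^sup>2 = of_int d" using E0 True by (simp add: power2_eq_square)
      then have "a = d" using squarefree_eq_of_times_rat_square[OF a(2) d(2)] a d by simp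
      then show ?thesis by simp
    next
      case 2
      then have "of_int b * q2\<^sup>2 = of_int d" using E0 True by (simp add: power2_eq_square)
      then have "b = d" using squarefree_eq_of_times_rat_square[OF b(2) d(2)] b d by simp
      then show ?thesis by simp
    next
      case 3
      then have "of_int d = q3\<^sup>2 * of_int a * of_int b"
        using E0 True by (simp add: power2_eq_square algebra_simps)
      then show ?thesis by blast
    qed
  qed
qed

lemma sqrt_in_biquad_field_le:
  assumes ab: "real_biquadratic a b" and d: "d > 1" "squarefree d"
    and h: "sqrt (of_int d) \<in> biquad_field a b"
  shows "d \<le> a * b"
proof -
  have a: "a > 1" and b: "b > 1" using ab unfolding real_biquadratic_def by auto
  consider "d = a" | "d = b" | z :: rat where "of_int d = z\<^sup>2 * of_int a * of_int b"
    using sqrt_in_biquad_field_cases[OF assms] by blast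
  then show ?thesis
  proof cases
    case 3
    then have "of_int d = z\<^sup>2 * of_int (a * b)" by simp
    then show ?thesis using squarefree_le_of_eq_rat_square_times[OF d(2)] a b d by simp
  qed (use a b in \<open>simp_all add: mult_le_cancel_left1 mult_le_cancel_right1\<close>)
qed

lemma sqrt_in_biquad_field: "a \<ge> 0 \<Longrightarrow> sqrt (of_int a) \<in> biquad_field a b"
  unfolding biquad_field_def by (intro CollectI exI[of _ "(0, 1, 0, 0)"]) (simp add: bq_elt_expand neg_if_def)

section \<open>Signatures\<close>

definition sig_all :: "bit ^ (bool \<times> bool)" where "sig_all = (\<chi> i. 1)"
definition sig_fst :: "bit ^ (bool \<times> bool)" where "sig_fst = (\<chi> i. if fst i then 1 else 0)"
definition sig_snd :: "bit ^ (bool \<times> bool)" where "sig_snd = (\<chi> i. if snd i then 1 else 0)"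

lemma bit_cases: "(x::bit) = 0 \<or> x = 1"
  by (cases x) auto

lemma even_weight_in_span:
  assumes "v $ (False, False) + v $ (False, True) + v $ (True, False) + v $ (True, True) = (0::bit)"
  shows "v \<in> vec.span {sig_all, sig_fst, sig_snd}"
proof -
  have "v $ (True, True) = v $ (False, False) + v $ (False, True) + v $ (True, False)"
    using assms bit_cases[of "v $ (False, False)"] bit_cases[of "v $ (False, True)"]
      bit_cases[of "v $ (True, False)"] bit_cases[of "v $ (True, True)"]
    by auto
  then have "v = v $ (False, False) *s sig_all + (v $ (True, False) + v $ (False, False)) *s sig_fst
                + (v $ (False, True) + v $ (False, False)) *s sig_snd"
    unfolding sig_all_def sig_fst_def sig_snd_def Finite_Cartesian_Product.vec_eq_iff
    using bit_cases[of "v $ (False, False)"] bit_cases[of "v $ (False, True)"] bit_cases[of "v $ (True, False)"]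
    by (auto simp: all_bool_eq)
  also have "\<dots> \<in> vec.span {sig_all, sig_fst, sig_snd}"
    by (intro vec.span_add vec.span_scale vec.span_base) simp_all
  finally show ?thesis .
qed

lemma independent_sig_all_fst_snd: "vec.independent {sig_all, sig_fst, sig_snd}"
proof -
  have "sig_fst $ (True, False) = 1" by (simp add: sig_fst_def)
  then have "sig_fst \<noteq> 0" by auto
  then have i1: "vec.independent {sig_fst}" by simp
  have "sig_snd \<notin> vec.span {sig_fst}"
  proof
    assume "sig_snd \<in> vec.span {sig_fst}"
    then obtain k where "sig_snd = k *s sig_fst" unfolding vec.span_singleton by auto
    then have "sig_snd $ (False, True) = (k *s sig_fst) $ (False, True)" by simp
    then show False unfolding sig_snd_def sig_fst_def by simp
  qed
  then have i2: "vec.independent {sig_snd, sig_fst}" by (rule vec.independent_insertI[OF _ i1])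
  have "sig_all \<notin> vec.span {sig_snd, sig_fst}"
  proof
    assume "sig_all \<in> vec.span {sig_snd, sig_fst}"
    then obtain k where "sig_all - k *s sig_snd \<in> vec.span {sig_fst}" unfolding vec.span_insert by auto
    then obtain k' where "sig_all - k *s sig_snd = k' *s sig_fst" unfolding vec.span_singleton by auto
    then have "(sig_all - k *s sig_snd) $ (False, False) = (k' *s sig_fst) $ (False, False)" by simp
    then show False unfolding sig_all_def sig_snd_def sig_fst_def by simp
  qed
  then have "vec.independent {sig_all, sig_snd, sig_fst}" by (rule vec.independent_insertI[OF _ i2])
  then show ?thesis by (simp add: insert_commute)
qed

text \<open>Three independent vectors in the even-weight hyperplane of \<open>\<bbbF>\<^sub>2\<^sup>4\<close> span it.\<close>

lemma dim_even_weight_eq_3: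
  fixes S :: "(bit ^ (bool \<times> bool)) set"
  assumes "sig_all \<in> S" "sig_fst \<in> S" "sig_snd \<in> S"
    and even: "\<And>v. v \<in> S \<Longrightarrow> v $ (False, False) + v $ (False, True) + v $ (True, False) + v $ (True, True) = 0"
  shows "vec.dim S = 3"
proof -
  have "sig_all $ (False, False) = 1" "sig_fst $ (False, False) = 0" "sig_snd $ (False, False) = 0"
    "sig_fst $ (True, False) = 1" "sig_snd $ (True, False) = 0"
    unfolding sig_all_def sig_fst_def sig_snd_def by simp_all
  then have "sig_all \<noteq> sig_fst" "sig_all \<noteq> sig_snd" "sig_fst \<noteq> sig_snd" by auto
  then have card: "card {sig_all, sig_fst, sig_snd} = 3" by simp
  have "vec.dim S \<le> card {sig_all, sig_fst, sig_snd}"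
    by (rule vec.dim_le_card) (use even even_weight_in_span in auto)
  moreover have "card {sig_all, sig_fst, sig_snd} \<le> vec.dim S"
    by (rule vec.independent_card_le_dim[OF _ independent_sig_all_fst_snd]) (use assms in auto)
  ultimately show ?thesis using card by simp
qed

lemma sign_bits_sum_eq_0_if_prod_pos:
  fixes x1 x2 x3 x4 :: real
  assumes "x1 * x2 * x3 * x4 > 0"
  shows "(if x1 < 0 then 1 else 0) + (if x2 < 0 then 1 else 0) + (if x3 < 0 then 1 else 0)
         + (if x4 < 0 then 1 else 0) = (0::bit)"
proof -
  have "x1 \<noteq> 0" "x2 \<noteq> 0" "x3 \<noteq> 0" "x4 \<noteq> 0" "(x1 * x2) * (x3 * x4) > 0"
    using assms by (auto simp: mult.assoc)
  then show ?thesis by (auto simp: zero_less_mult_iff mult_less_0_iff linorder_neq_iff)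
qed

lemma bq_signature_even_weight:
  assumes "bq_norm a b q > 0"
  shows "bq_signature a b q $ (False, False) + bq_signature a b q $ (False, True)
       + bq_signature a b q $ (True, False) + bq_signature a b q $ (True, True) = 0"
  using sign_bits_sum_eq_0_if_prod_pos[OF assms[unfolded bq_norm_def]] unfolding bq_signature_def by simp

lemma quad_unit_cnj_neg:
  assumes "d \<ge> 0" "quad_norm d p = -1" "quad_elt d p > 0"
  shows "quad_elt d (quad_cnj p) < 0"
proof (rule ccontr)
  assume "\<not> quad_elt d (quad_cnj p) < 0"
  then have "quad_elt d p * quad_elt d (quad_cnj p) \<ge> 0" using assms(3) by simp
  then show False using quad_norm_eq[OF assms(1), of p] assms(2) by simp
qed

lemma bq_elt_quad_a: "bq_elt a b s t (x, y, 0, 0) = (if s then quad_elt a (quad_cnj (x, y)) else quad_elt a (x, y))"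
  by (simp add: bq_elt_expand neg_if_def quad_elt_def quad_cnj_def of_rat_minus)

lemma bq_elt_quad_b: "bq_elt a b s t (x, 0, y, 0) = (if t then quad_elt b (quad_cnj (x, y)) else quad_elt b (x, y))"
  by (simp add: bq_elt_expand neg_if_def quad_elt_def quad_cnj_def of_rat_minus)

theorem unit_signature_rank_eq_3:
  assumes ab: "real_biquadratic a b"
    and pos: "\<And>q. q \<in> bq_units a b \<Longrightarrow> bq_norm a b q > 0"
    and ua: "ua \<in> quad_units a" "quad_norm a ua = -1" "quad_elt a ua > 0"
    and ub: "ub \<in> quad_units b" "quad_norm b ub = -1" "quad_elt b ub > 0"
  shows "unit_signature_rank a b = 3"
proof -
  note ab0 = real_biquadratic_nonneg[OF ab]
  define S where "S = bq_signature a b ` bq_units a b"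
  obtain x y x' y' where u: "ua = (x, y)" "ub = (x', y')" by fastforce
  have "algebraic_int (-1 :: real)" by (intro algebraic_int_minus int_imp_algebraic_int) auto
  then have "(-1, 0, 0, 0) \<in> bq_units a b" unfolding bq_units_def by simp
  moreover have "(x, y, 0, 0) \<in> bq_units a b" "(x', 0, y', 0) \<in> bq_units a b"
    using ua(1) ub(1) unfolding u quad_units_def bq_units_def by (auto simp: bq_elt_quad_a bq_elt_quad_b)
  moreover have "bq_elt a b s t (x, y, 0, 0) < 0 \<longleftrightarrow> s" "bq_elt a b s t (x', 0, y', 0) < 0 \<longleftrightarrow> t" for s t
    using ua(3) ub(3) quad_unit_cnj_neg[OF ab0(1) ua(2,3)] quad_unit_cnj_neg[OF ab0(2) ub(2,3)]
    unfolding u by (simp_all add: bq_elt_quad_a bq_elt_quad_b)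
  then have "bq_signature a b (x, y, 0, 0) = sig_fst" "bq_signature a b (x', 0, y', 0) = sig_snd"
    "bq_signature a b (-1, 0, 0, 0) = sig_all"
    unfolding bq_signature_def sig_fst_def sig_snd_def sig_all_def by simp_all
  ultimately have "sig_all \<in> S" "sig_fst \<in> S" "sig_snd \<in> S" unfolding S_def by (metis image_eqI)+
  moreover have "v $ (False, False) + v $ (False, True) + v $ (True, False) + v $ (True, True) = 0"
    if "v \<in> S" for v
    using that pos bq_signature_even_weight unfolding S_def by blast
  ultimately have "vec.dim S = 3" by (intro dim_even_weight_eq_3)
  then show ?thesis unfolding unit_signature_rank_def S_def .
qed

section \<open>The family\<close>

lemma no_square_strictly_between:
  fixes m x :: int
  assumes "m \<ge> 0" "m\<^sup>2 < x\<^sup>2" "x\<^sup>2 < (m + 1)\<^sup>2"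
  shows False
proof -
  have "m < \<bar>x\<bar>" using assms(1,2) abs_le_square_iff[of x m] by auto
  moreover have "\<bar>x\<bar> < m + 1" using assms(1,3) abs_le_square_iff[of "m + 1" x] by auto
  ultimately show False by simp
qed

lemma squarefree_part_square_part_pos:
  fixes n :: int
  assumes "n > 0"
  shows "squarefree_part n > 0" "square_part n > 0"
proof -
  have "square_part n \<noteq> 0" using assms square_part_0_iff[of n] by auto
  moreover have "\<bar>square_part n\<bar> = square_part n" using normalize_square_part[of n] by simp
  then have "square_part n \<ge> 0" by (metis abs_ge_zero)
  ultimately show sq: "square_part n > 0" by linarith
  show "squarefree_part n > 0"
    using assms squarefree_decompose[of n] sq by (metis zero_less_mult_pos2 zero_less_power)
qed

lemma squarefree_part_gt_1_if_not_square:
  fixes n :: int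
  assumes "n > 0" "\<And>k. n \<noteq> k\<^sup>2"
  shows "squarefree_part n > 1"
proof -
  have "squarefree_part n \<noteq> 1"
  proof
    assume "squarefree_part n = 1"
    then have "n = (square_part n)\<^sup>2" using squarefree_decompose[of n] by simp
    then show False using assms(2) by blast
  qed
  then show ?thesis using squarefree_part_square_part_pos[OF assms(1)] by linarith
qed

lemma square_plus_1_not_square:
  fixes m :: int
  assumes "m \<ge> 1"
  shows "m\<^sup>2 + 1 \<noteq> k\<^sup>2"
proof
  assume "m\<^sup>2 + 1 = k\<^sup>2"
  then show False
    using no_square_strictly_between[of m k] assms by (simp add: power2_eq_square algebra_simps)
qed

text \<open>The family: \<open>a\<close>, \<open>b\<close> are the squarefree parts of \<open>m\<^sup>2 + 1 = a f\<^sub>a\<^sup>2\<close> and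
  \<open>(m + 1)\<^sup>2 + 1 = b f\<^sub>b\<^sup>2\<close>; then \<open>m + f\<^sub>a\<surd>a\<close>, \<open>m + 1 + f\<^sub>b\<surd>b\<close> and, as
  \<open>(m\<^sup>2 + 1)((m + 1)\<^sup>2 + 1) = (m\<^sup>2 + m + 1)\<^sup>2 + 1\<close>, \<open>m\<^sup>2 + m + 1 + f\<^sub>af\<^sub>b\<surd>ab\<close> are units of norm \<open>-1\<close>.\<close>

lemma square_plus_1_product:
  fixes m :: int
  shows "(m\<^sup>2 + 1) * ((m + 1)\<^sup>2 + 1) = (m\<^sup>2 + m + 1)\<^sup>2 + 1"
  by (simp add: power2_eq_square algebra_simps)

lemma real_biquadratic_square_plus_1:
  fixes m :: int
  assumes m: "m \<ge> 1"
  shows "real_biquadratic (squarefree_part (m\<^sup>2 + 1)) (squarefree_part ((m + 1)\<^sup>2 + 1))"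
proof -
  define a b where "a = squarefree_part (m\<^sup>2 + 1)" "b = squarefree_part ((m + 1)\<^sup>2 + 1)"
  have pos: "m\<^sup>2 + 1 > 0" "(m + 1)\<^sup>2 + 1 > 0" by (simp_all add: add_pos_nonneg)
  have "a > 1" "b > 1"
    unfolding a_b_def using square_plus_1_not_square[of m] square_plus_1_not_square[of "m + 1"] m
    by (auto intro!: squarefree_part_gt_1_if_not_square pos)
  moreover have "a \<noteq> b"
  proof
    assume "a = b"
    define fa fb where "fa = square_part (m\<^sup>2 + 1)" "fb = square_part ((m + 1)\<^sup>2 + 1)"
    have "(m\<^sup>2 + 1) * ((m + 1)\<^sup>2 + 1) = (a * fa\<^sup>2) * (b * fb\<^sup>2)"
      unfolding a_b_def fa_fb_def by (simp flip: squarefree_decompose)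
    also have "\<dots> = (a * fa * fb)\<^sup>2" using \<open>a = b\<close> by (simp add: power2_eq_square mult_ac)
    finally have "(m\<^sup>2 + m + 1)\<^sup>2 + 1 = (a * fa * fb)\<^sup>2" unfolding square_plus_1_product .
    moreover have "m\<^sup>2 + m + 1 \<ge> 1" using m zero_le_power2[of m] by linarith
    ultimately show False using square_plus_1_not_square by blast
  qed
  ultimately show ?thesis unfolding real_biquadratic_def a_b_def by simp
qed

lemma pell_of_squarefree_part:
  fixes x :: int
  shows "of_int (squarefree_part (x\<^sup>2 + 1)) * (of_int (square_part (x\<^sup>2 + 1)))\<^sup>2 = (of_int x :: rat)\<^sup>2 + 1"
  using squarefree_decompose[of "x\<^sup>2 + 1"] by (metis of_int_1 of_int_add of_int_mult of_int_power)

lemma fundamental_units_square_plus_1: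
  fixes m :: int
  assumes m: "m \<ge> 1" and d: "squarefree d" "d > 1"
    and dK: "sqrt (of_int d) \<in> biquad_field (squarefree_part (m\<^sup>2 + 1)) (squarefree_part ((m + 1)\<^sup>2 + 1))"
  obtains e where "fundamental_unit d e" "quad_norm d e = -1"
proof -
  define a b where "a = squarefree_part (m\<^sup>2 + 1)" "b = squarefree_part ((m + 1)\<^sup>2 + 1)"
  define fa fb where "fa = square_part (m\<^sup>2 + 1)" "fb = square_part ((m + 1)\<^sup>2 + 1)"
  have pa: "of_int a * (of_int fa)\<^sup>2 = (of_int m :: rat)\<^sup>2 + 1"
    and pb: "of_int b * (of_int fb)\<^sup>2 = (of_int (m + 1) :: rat)\<^sup>2 + 1"
    unfolding a_b_def fa_fb_def by (rule pell_of_squarefree_part)+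
  consider "d = a" | "d = b" | z :: rat where "of_int d = z\<^sup>2 * of_int a * of_int b"
    using sqrt_in_biquad_field_cases[OF real_biquadratic_square_plus_1[OF m] d(2,1)] dK
    unfolding a_b_def by blast
  then show ?thesis
  proof cases
    case 1
    then have "of_int d * (of_int fa)\<^sup>2 = (of_int m :: rat)\<^sup>2 + 1" using pa by simp
    then show ?thesis using fundamental_unit_norm_minus_1_of_pell[OF d] that by blast
  next
    case 2
    then have "of_int d * (of_int fb)\<^sup>2 = (of_int (m + 1) :: rat)\<^sup>2 + 1" using pb by simp
    then show ?thesis using fundamental_unit_norm_minus_1_of_pell[OF d] that by blast
  next
    case 3
    then have "z \<noteq> 0" using d(2) by auto
    have "of_int d * (of_int (fa * fb) / z)\<^sup>2 = (of_int a * (of_int fa)\<^sup>2) * (of_int b * (of_int fb)\<^sup>2)"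
      using 3 \<open>z \<noteq> 0\<close> by (simp add: power2_eq_square field_simps)
    also have "\<dots> = of_int ((m\<^sup>2 + 1) * ((m + 1)\<^sup>2 + 1))" unfolding pa pb by simp
    also have "\<dots> = (of_int (m\<^sup>2 + m + 1))\<^sup>2 + 1" unfolding square_plus_1_product by simp
    finally show ?thesis using fundamental_unit_norm_minus_1_of_pell[OF d] that by blast
  qed
qed

lemma prime_13: "prime (13::int)"
  unfolding prime_int_iff'
proof (intro conjI ballI)
  fix n :: int assume "n \<in> {2..<13}"
  then have "2 \<le> n" "n < 13" by auto
  then have "n = 2 \<or> n = 3 \<or> n = 4 \<or> n = 5 \<or> n = 6 \<or> n = 7 \<or> n = 8 \<or> n = 9 \<or> n = 10 \<or> n = 11 \<or> n = 12"
    by presburger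
  then show "\<not> n dvd 13" by auto
qed simp

lemma not_square_6_mod_13: "\<not> [z * z = 6] (mod (13::int))"
proof
  assume h: "[z * z = 6] (mod 13)"
  define y where "y = z mod 13"
  have y: "0 \<le> y" "y < 13" unfolding y_def by auto
  have "[y * y = z * z] (mod 13)" unfolding y_def by (intro cong_mult) (simp_all add: cong_def)
  then have "[y * y = 6] (mod 13)" using h by (rule cong_trans)
  then have e: "(y * y) mod 13 = 6" by (simp add: cong_def)
  have "y = 0 \<or> y = 1 \<or> y = 2 \<or> y = 3 \<or> y = 4 \<or> y = 5 \<or> y = 6 \<or> y = 7 \<or> y = 8 \<or> y = 9 \<or> y = 10
      \<or> y = 11 \<or> y = 12"
    using y by presburger
  then show False using e by auto
qed

text \<open>For \<open>m \<equiv> 4 (mod 169)\<close>: \<open>m\<^sup>2 + 1 \<equiv> 4 (mod 13)\<close> and \<open>(m + 1)\<^sup>2 + 1 \<equiv> 26 (mod 169)\<close>, so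
  \<open>13\<close> divides \<open>b\<close> but not \<open>a\<close>, \<open>a \<equiv> (2/f\<^sub>a)\<^sup>2\<close>, and \<open>m + f\<^sub>a\<surd>a\<close> reduces to the non-square
  \<open>4 + 2 = 6\<close>.\<close>

lemma square_plus_1_mod_13:
  fixes j :: int
  defines "m \<equiv> 169 * j + 4"
  shows "\<not> 13 dvd squarefree_part (m\<^sup>2 + 1)" "13 dvd squarefree_part ((m + 1)\<^sup>2 + 1)"
    "\<exists>r. [r * r = squarefree_part (m\<^sup>2 + 1)] (mod 13) \<and> [m + square_part (m\<^sup>2 + 1) * r = 6] (mod 13)"
proof -
  define a b where "a = squarefree_part (m\<^sup>2 + 1)" "b = squarefree_part ((m + 1)\<^sup>2 + 1)"
  define fa fb where "fa = square_part (m\<^sup>2 + 1)" "fb = square_part ((m + 1)\<^sup>2 + 1)"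
  have A: "a * fa\<^sup>2 = 13 * (2197 * j\<^sup>2 + 104 * j + 1) + 4"
    and B: "b * fb\<^sup>2 = 169 * (169 * j\<^sup>2 + 10 * j) + 26"
    using squarefree_decompose[of "m\<^sup>2 + 1"] squarefree_decompose[of "(m + 1)\<^sup>2 + 1"]
    unfolding a_b_def fa_fb_def m_def by (simp_all add: power2_eq_square algebra_simps)
  have nA: "\<not> 13 dvd a * fa\<^sup>2" unfolding A dvd_add_right_iff[OF dvd_triv_left] by simp
  then show "\<not> 13 dvd squarefree_part (m\<^sup>2 + 1)" using dvd_mult2 unfolding a_b_def by blast
  show "13 dvd squarefree_part ((m + 1)\<^sup>2 + 1)"
  proof (rule ccontr)
    assume "\<not> 13 dvd squarefree_part ((m + 1)\<^sup>2 + 1)"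
    then have nb: "\<not> 13 dvd b" unfolding a_b_def .
    have "b * fb\<^sup>2 = 13 * (13 * (169 * j\<^sup>2 + 10 * j) + 2)" unfolding B by simp
    then have "13 dvd b * fb\<^sup>2" by simp
    then have "13 dvd fb\<^sup>2" using nb prime_dvd_mult_iff[OF prime_13] by blast
    then have "13 dvd fb" by (rule prime_dvd_power[OF prime_13])
    then have "169 dvd b * fb\<^sup>2" by (auto simp: power2_eq_square)
    then show False unfolding B dvd_add_right_iff[OF dvd_triv_left] by simp
  qed
  have "\<not> 13 dvd fa"
  proof
    assume "13 dvd fa"
    then have "13 dvd a * fa\<^sup>2" by (simp add: power2_eq_square)
    then show False using nA by contradiction
  qed
  then have "coprime fa 13" using prime_imp_coprime[OF prime_13] by (simp add: coprime_commute)
  then obtain t where t: "[fa * t = 1] (mod 13)" using cong_solve_coprime_int by blast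
  have "[a * fa * fa = 4] (mod 13)" using A by (simp add: power2_eq_square mult.assoc cong_iff_dvd_diff)
  then have "[(a * fa * fa) * (t * t) = 4 * (t * t)] (mod 13)" by (intro cong_mult cong_refl)
  moreover have "[(a * fa * fa) * (t * t) = a] (mod 13)"
  proof -
    have "[a * ((fa * t) * (fa * t)) = a * (1 * 1)] (mod 13)" using t by (intro cong_mult cong_refl)
    then show ?thesis by (simp add: algebra_simps)
  qed
  ultimately have "[a = 4 * (t * t)] (mod 13)" by (metis cong_sym cong_trans)
  then have r: "[(2 * t) * (2 * t) = a] (mod 13)" by (simp add: algebra_simps cong_sym_eq)
  have "[m + 2 * (fa * t) = 4 + 2 * 1] (mod 13)"
    using t unfolding m_def by (intro cong_add cong_mult cong_refl) (simp add: cong_iff_dvd_diff)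
  then have "[m + fa * (2 * t) = 6] (mod 13)" by (simp add: algebra_simps)
  then show "\<exists>r. [r * r = squarefree_part (m\<^sup>2 + 1)] (mod 13) \<and> [m + square_part (m\<^sup>2 + 1) * r = 6] (mod 13)"
    using r unfolding a_b_def fa_fb_def by blast
qed

lemma unit_signature_rank_square_plus_1:
  fixes j :: int
  assumes "j \<ge> 0"
  defines "m \<equiv> 169 * j + 4"
  shows "unit_signature_rank (squarefree_part (m\<^sup>2 + 1)) (squarefree_part ((m + 1)\<^sup>2 + 1)) = 3"
proof -
  define a b where "a = squarefree_part (m\<^sup>2 + 1)" "b = squarefree_part ((m + 1)\<^sup>2 + 1)"
  define fa fb where "fa = square_part (m\<^sup>2 + 1)" "fb = square_part ((m + 1)\<^sup>2 + 1)"
  have m: "m \<ge> 1" unfolding m_def using assms(1) by simp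
  have ab: "real_biquadratic a b" unfolding a_b_def using real_biquadratic_square_plus_1[OF m] .
  note ab0 = real_biquadratic_nonneg[OF ab]
  have "m\<^sup>2 + 1 > 0" "(m + 1)\<^sup>2 + 1 > 0" by (simp_all add: add_pos_nonneg)
  then have f: "fa > 0" "fb > 0" unfolding fa_fb_def using squarefree_part_square_part_pos(2) by blast+
  define ua ub where "ua = (of_int m :: rat, of_int fa :: rat)" "ub = (of_int (m + 1) :: rat, of_int fb :: rat)"
  have "of_int a * (of_int fa)\<^sup>2 = (of_int m :: rat)\<^sup>2 + 1"
    and "of_int b * (of_int fb)\<^sup>2 = (of_int (m + 1) :: rat)\<^sup>2 + 1"
    unfolding a_b_def fa_fb_def by (rule pell_of_squarefree_part)+
  from quad_unit_of_pell[OF ab0(1) _ this(1)] quad_unit_of_pell[OF ab0(2) _ this(2)] f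
  have ua: "ua \<in> quad_units a" "quad_norm a ua = -1"
    and ub: "ub \<in> quad_units b" "quad_norm b ub = -1"
    unfolding ua_ub_def by simp_all
  have "quad_elt a ua > 0" "quad_elt b ub > 0"
    unfolding ua_ub_def quad_elt_def using m f ab0 by (simp_all add: add_pos_nonneg)
  note ua = ua this(1) and ub = ub this(2)
  obtain r where r: "[r * r = a] (mod 13)" and G: "[m + fa * r = 6] (mod 13)"
    using square_plus_1_mod_13(3)[of j] unfolding a_b_def fa_fb_def m_def by blast
  have "quad_cong 13 r ua (m + fa * r)" unfolding ua_ub_def by (intro quad_cong_intro rat_cong_of_int)
  moreover have "\<not> [z * z = m + fa * r] (mod 13)" for z
    using not_square_6_mod_13[of z] G cong_trans by blast
  moreover have "[5 * 5 = -1] (mod (13::int))" by (simp add: cong_def)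
  moreover have "odd (13::int)" "13 dvd b" "\<not> 13 dvd a"
    using square_plus_1_mod_13(1,2)[of j] unfolding a_b_def m_def by simp_all
  ultimately have "bq_norm a b q > 0" if "q \<in> bq_units a b" for q
    using bq_units_norm_pos[OF ab prime_13 _ _ _ r _ ua(1,2)] that by blast
  then show ?thesis using unit_signature_rank_eq_3[OF ab _ ua ub] unfolding a_b_def by blast
qed

section \<open>Infinitely many fields\<close>

text \<open>A prime factor of \<open>(n!)\<^sup>2 + 1\<close> exceeds \<open>n\<close>.\<close>

lemma prime_dvd_square_plus_1_gt:
  fixes N :: int
  obtains q M where "prime q" "q > N" "q dvd M\<^sup>2 + 1"
proof -
  define n where "n = nat \<bar>N\<bar>"
  define M where "M = (fact n :: int)"
  have "M \<ge> 1" unfolding M_def by simp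
  then have "\<bar>M\<^sup>2 + 1\<bar> \<noteq> 1" by (simp add: add_pos_nonneg)
  then obtain q where q: "prime q" "q dvd M\<^sup>2 + 1" using prime_factor_int by blast
  have q1: "q > 1" using prime_gt_1_int[OF q(1)] .
  have "q > N"
  proof (rule ccontr)
    assume "\<not> q > N"
    then have "nat q \<le> n" unfolding n_def by simp
    then have "nat q dvd fact n" using q1 by (intro dvd_fact) auto
    then have "int (nat q) dvd int (fact n)" by (simp only: of_nat_dvd_iff)
    then have "q dvd M" unfolding M_def using q1 by (simp add: of_nat_fact)
    then have "q dvd M\<^sup>2" by (simp add: power2_eq_square)
    then have "q dvd 1" using q(2) by (simp add: dvd_add_right_iff)
    then show False using q1 by simp
  qed
  then show ?thesis using q that by blast
qed

text \<open>As \<open>q\<close> is prime to \<open>2 \<cdot> 13\<close>, some \<open>m \<equiv> 4 (mod 169)\<close> has \<open>q | m\<^sup>2 + 1\<close>, and of the two lifts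
  \<open>m\<close> and \<open>m + 169q\<close> at most one has \<open>q\<^sup>2 | m\<^sup>2 + 1\<close>.\<close>

lemma prime_exactly_dvd_square_plus_1_family:
  fixes q M :: int
  assumes q: "prime q" "q > 13" "q dvd M\<^sup>2 + 1"
  obtains j where "j \<ge> 0" "q dvd (169 * j + 4)\<^sup>2 + 1" "\<not> q\<^sup>2 dvd (169 * j + 4)\<^sup>2 + 1"
proof -
  have q0: "q > 0" using q(2) by simp
  have "\<not> q dvd 2" "\<not> q dvd 13" using q(2) by (auto dest: zdvd_imp_le)
  then have "\<not> q dvd 13 * 13" "\<not> q dvd 2 * (13 * 13)"
    using prime_dvd_mult_iff[OF q(1)] by blast+
  then have q169: "\<not> q dvd 169" "\<not> q dvd 338" by simp_all
  then have "coprime 169 q" using prime_imp_coprime[OF q(1) q169(1)] coprime_commute by blast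
  then obtain i where i: "[169 * i = 1] (mod q)" using cong_solve_coprime_int by blast
  define j0 where "j0 = ((M - 4) * i) mod q"
  define m0 where "m0 = 169 * j0 + 4"
  have j0: "j0 \<ge> 0" unfolding j0_def using q0 by simp
  have "[169 * j0 = 169 * ((M - 4) * i)] (mod q)" unfolding j0_def by (intro cong_mult cong_refl) (simp add: cong_def)
  also have "169 * ((M - 4) * i) = (M - 4) * (169 * i)" by simp
  also have "[(M - 4) * (169 * i) = (M - 4) * 1] (mod q)" using i by (intro cong_mult cong_refl)
  finally have "[m0 = M] (mod q)" unfolding m0_def using cong_add[OF _ cong_refl[of 4]] by fastforce
  then have "[m0\<^sup>2 + 1 = M\<^sup>2 + 1] (mod q)" by (intro cong_add cong_pow cong_refl)
  then have qm0: "q dvd m0\<^sup>2 + 1" using q(3) by (simp add: cong_dvd_iff)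
  have "\<not> q dvd m0"
  proof
    assume "q dvd m0"
    then have "q dvd m0\<^sup>2" by (simp add: power2_eq_square)
    then have "q dvd 1" using qm0 by (simp add: dvd_add_right_iff)
    then show False using q(2) by simp
  qed
  show ?thesis
  proof (cases "q\<^sup>2 dvd m0\<^sup>2 + 1")
    case False
    then show ?thesis using that j0 qm0 unfolding m0_def by blast
  next
    case True
    have e: "(169 * (j0 + q) + 4)\<^sup>2 + 1 = (m0\<^sup>2 + 1) + q * (338 * m0) + q\<^sup>2 * 28561"
      unfolding m0_def by (simp add: power2_eq_square algebra_simps)
    have "\<not> q\<^sup>2 dvd (169 * (j0 + q) + 4)\<^sup>2 + 1"
    proof
      assume "q\<^sup>2 dvd (169 * (j0 + q) + 4)\<^sup>2 + 1"
      then have "q\<^sup>2 dvd ((169 * (j0 + q) + 4)\<^sup>2 + 1) - (m0\<^sup>2 + 1) - q\<^sup>2 * 28561"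
        using True by (intro dvd_diff) simp_all
      then have "q * q dvd q * (338 * m0)" unfolding e by (simp add: power2_eq_square)
      then have "q dvd 338 * m0" using q0 by simp
      then show False using q169(2) \<open>\<not> q dvd m0\<close> prime_dvd_mult_iff[OF q(1)] by blast
    qed
    moreover have "q dvd (169 * (j0 + q) + 4)\<^sup>2 + 1" unfolding e using qm0 by (simp add: power2_eq_square)
    moreover have "j0 + q \<ge> 0" using j0 q0 by simp
    ultimately show ?thesis using that by blast
  qed
qed

lemma prime_dvd_squarefree_part:
  fixes q n :: int
  assumes q: "prime q" and "q dvd n" "\<not> q\<^sup>2 dvd n"
  shows "q dvd squarefree_part n"
proof (rule ccontr)
  assume "\<not> q dvd squarefree_part n"
  moreover have "q dvd squarefree_part n * (square_part n)\<^sup>2"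
    using assms(2) squarefree_decompose[of n] by simp
  ultimately have "q dvd (square_part n)\<^sup>2" using prime_dvd_mult_iff[OF q] by blast
  then have "q dvd square_part n" by (rule prime_dvd_power[OF q])
  then have "q\<^sup>2 dvd (square_part n)\<^sup>2" by (simp add: power2_eq_square mult_dvd_mono)
  then have "q\<^sup>2 dvd squarefree_part n * (square_part n)\<^sup>2" by (rule dvd_mult)
  then show False using assms(3) squarefree_decompose[of n] by simp
qed

lemma squarefree_part_family_unbounded:
  fixes N :: int
  obtains j where "j \<ge> 0" "squarefree_part ((169 * j + 4)\<^sup>2 + 1) > N"
proof -
  obtain q M where q: "prime q" "q > max N 13" "q dvd M\<^sup>2 + 1"
    using prime_dvd_square_plus_1_gt by blast
  then obtain j where j: "j \<ge> 0" "q dvd (169 * j + 4)\<^sup>2 + 1" "\<not> q\<^sup>2 dvd (169 * j + 4)\<^sup>2 + 1"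
    using prime_exactly_dvd_square_plus_1_family[of q M] by auto
  have "(169 * j + 4)\<^sup>2 + 1 > 0" by (simp add: add_pos_nonneg)
  then have "squarefree_part ((169 * j + 4)\<^sup>2 + 1) > 0" by (rule squarefree_part_square_part_pos(1))
  then have "q \<le> squarefree_part ((169 * j + 4)\<^sup>2 + 1)"
    using prime_dvd_squarefree_part[OF q(1) j(2,3)] by (simp add: zdvd_imp_le)
  then show ?thesis using that j(1) q(2) by simp
qed

theorem corollary4p9:
  shows "infinite {K :: real set. \<exists>a b. real_biquadratic a b \<and> K = biquad_field a b \<and>
           (\<forall>d::int. d > 1 \<and> squarefree d \<and> sqrt (of_int d) \<in> K \<longrightarrow>
               (\<exists>e. fundamental_unit d e \<and> quad_norm d e = -1)) \<and>
           unit_signature_rank a b = 3}"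
  (is "infinite ?F")
proof
  assume fin: "finite ?F"
  have "\<forall>K\<in>?F. \<exists>B. \<forall>d. d > 1 \<and> squarefree d \<and> sqrt (of_int d) \<in> K \<longrightarrow> d \<le> B"
    using sqrt_in_biquad_field_le by blast
  then obtain B where B: "\<forall>K\<in>?F. \<forall>d. d > 1 \<and> squarefree d \<and> sqrt (of_int d) \<in> K \<longrightarrow> d \<le> B K"
    by (rule bchoice[THEN exE])
  obtain j where j: "j \<ge> 0" "squarefree_part ((169 * j + 4)\<^sup>2 + 1) > Max (B ` ?F)"
    using squarefree_part_family_unbounded by blast
  define m where "m = 169 * j + 4"
  define a b where "a = squarefree_part (m\<^sup>2 + 1)" "b = squarefree_part ((m + 1)\<^sup>2 + 1)"
  have m: "m \<ge> 1" unfolding m_def using j(1) by simp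
  have ab: "real_biquadratic a b" unfolding a_b_def using real_biquadratic_square_plus_1[OF m] .
  have K: "biquad_field a b \<in> ?F"
    using ab fundamental_units_square_plus_1[OF m] unit_signature_rank_square_plus_1[OF j(1)]
    unfolding a_b_def m_def by blast
  have "a > 1" "squarefree a" using ab unfolding real_biquadratic_def by auto
  then have "a \<le> B (biquad_field a b)" using B K sqrt_in_biquad_field[of a b] by auto
  also have "\<dots> \<le> Max (B ` ?F)" using fin K by simp
  finally show False using j(2) unfolding a_b_def m_def by simp
qed

end
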